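(* Let $\mathcal C$ be a class of topological semigroups containing all $0$-discrete Hausdorff topological semigroups and all Polish topological semigroups. Let $X$ be an injectively $\mathcal C$-closed semigroup admitting a separable subinvariant metric. If $\mathrm{cov}(\mathcal M)=\mathfrak c$, then $X$ is polybounded.
   Context: $\mathfrak c$ is the cardinality of the continuum and $\mathrm{cov}(\mathcal M)$ is the smallest cardinality of a cover of the real line by meager sets. A topological semigroup is a semigroup with a topology making the binary operation continuous. It is Polish if its topology is Polish. A topological semigroup $X$ is $0$-discrete if $X$ has a unique non-isolated point $0\in X$ and $0x=0=x0$ for all $x\in X$. For a class $\mathcal C$ of topological semigroups, a semigroup $X$ (carrying no topology) is injectively $\mathcal C$-closed if for any injective homomorphism $h:X\to Y$ to a topological semigroup $Y\in\mathcal C$ the image $h[X]$ is closed in $Y$. For a semigroup $X$, $X^1=X\cup\{1\}$, where $1\notin X$ is a new element with $1x=x=x1$ for every $x\in X^1$. A metric $d$ on $X$ is subinvariant if $d(axb,ayb)\le d(x,y)$ for all $x,y\in X$ and $a,b\in X^1$. A subset $A\subseteq X$ is algebraic if $A=\{x\in X: a_0xa_1x\cdots xa_n=b\}$ for some integer $n\ge 1$, some $b\in X$ and some $a_0,\dots,a_n\in X^1$. A semigroup $X$ is polybounded if $X$ is the union of finitely many algebraic subsets of $X$. *)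

theory Defs
  imports "HOL-Analysis.Analysis"
begin

unbundle cardinal_syntax

section \<open>Semigroups on a carrier set\<close>

definition semigroup_on :: "'a set \<Rightarrow> ('a \<Rightarrow> 'a \<Rightarrow> 'a) \<Rightarrow> bool" where
  "semigroup_on S m \<longleftrightarrow>
     (\<forall>x\<in>S. \<forall>y\<in>S. m x y \<in> S) \<and>
     (\<forall>x\<in>S. \<forall>y\<in>S. \<forall>z\<in>S. m (m x y) z = m x (m y z))"

text \<open>The semigroup \<open>X\<^sup>1\<close> always receives a new unit, even if \<open>X\<close> already has one.
  The new unit is \<^const>\<open>None\<close>, and \<open>x \<in> X\<close> is embedded as \<open>Some x\<close>.\<close>

definition carrier1 :: "'a set \<Rightarrow> 'a option set" where
  "carrier1 S = insert None (Some ` S)"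

fun mult1 :: "('a \<Rightarrow> 'a \<Rightarrow> 'a) \<Rightarrow> 'a option \<Rightarrow> 'a option \<Rightarrow> 'a option" where
  "mult1 m None y = y"
| "mult1 m (Some x) None = Some x"
| "mult1 m (Some x) (Some y) = Some (m x y)"

text \<open>\<open>word_eval m a n x\<close> is the product \<open>a\<^sub>0 x a\<^sub>1 x \<dots> x a\<^sub>n\<close> in \<open>X\<^sup>1\<close>.\<close>

primrec word_eval :: "('a \<Rightarrow> 'a \<Rightarrow> 'a) \<Rightarrow> (nat \<Rightarrow> 'a option) \<Rightarrow> nat \<Rightarrow> 'a \<Rightarrow> 'a option" where
  "word_eval m a 0 x = a 0"
| "word_eval m a (Suc n) x = mult1 m (mult1 m (word_eval m a n x) (Some x)) (a (Suc n))"

definition algebraic_in :: "'a set \<Rightarrow> ('a \<Rightarrow> 'a \<Rightarrow> 'a) \<Rightarrow> 'a set \<Rightarrow> bool" where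
  "algebraic_in S m A \<longleftrightarrow>
     (\<exists>n\<ge>1. \<exists>b\<in>S. \<exists>a. (\<forall>i\<le>n. a i \<in> carrier1 S) \<and> A = {x \<in> S. word_eval m a n x = Some b})"

definition polybounded :: "'a set \<Rightarrow> ('a \<Rightarrow> 'a \<Rightarrow> 'a) \<Rightarrow> bool" where
  "polybounded S m \<longleftrightarrow> (\<exists>F. finite F \<and> (\<forall>A\<in>F. algebraic_in S m A) \<and> S = \<Union>F)"

text \<open>For \<open>x \<in> X\<close> the product \<open>a x b\<close> in \<open>X\<^sup>1\<close> lies in \<open>X\<close>, that is, it is never \<^const>\<open>None\<close>,
  so \<^const>\<open>the\<close> only removes the embedding.\<close>

definition sandwich :: "('a \<Rightarrow> 'a \<Rightarrow> 'a) \<Rightarrow> 'a option \<Rightarrow> 'a \<Rightarrow> 'a option \<Rightarrow> 'a" where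
  "sandwich m a x b = the (mult1 m (mult1 m a (Some x)) b)"

lemma Some_sandwich: "Some (sandwich m a x b) = mult1 m (mult1 m a (Some x)) b"
  by (cases a; cases b) (simp_all add: sandwich_def)

definition subinvariant :: "'a set \<Rightarrow> ('a \<Rightarrow> 'a \<Rightarrow> 'a) \<Rightarrow> ('a \<Rightarrow> 'a \<Rightarrow> real) \<Rightarrow> bool" where
  "subinvariant S m d \<longleftrightarrow>
     (\<forall>x\<in>S. \<forall>y\<in>S. \<forall>a\<in>carrier1 S. \<forall>b\<in>carrier1 S.
        d (sandwich m a x b) (sandwich m a y b) \<le> d x y)"

section \<open>Topological semigroups\<close>

text \<open>A topological semigroup is a pair of a multiplication and a topology, whose
  \<^const>\<open>topspace\<close> is the carrier.\<close>

type_synonym 'b topsemi = "('b \<Rightarrow> 'b \<Rightarrow> 'b) \<times> 'b topology"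

definition topological_semigroup :: "'b topsemi \<Rightarrow> bool" where
  "topological_semigroup Y \<longleftrightarrow>
     semigroup_on (topspace (snd Y)) (fst Y) \<and>
     continuous_map (prod_topology (snd Y) (snd Y)) (snd Y) (\<lambda>(x, y). fst Y x y)"

definition polish_topology :: "'b topology \<Rightarrow> bool" where
  "polish_topology T \<longleftrightarrow> separable_space T \<and> completely_metrizable_space T"

definition polish_semigroup :: "'b topsemi \<Rightarrow> bool" where
  "polish_semigroup Y \<longleftrightarrow> topological_semigroup Y \<and> polish_topology (snd Y)"

definition zero_discrete_semigroup :: "'b topsemi \<Rightarrow> bool" where
  "zero_discrete_semigroup Y \<longleftrightarrow>
     topological_semigroup Y \<and>
     (\<exists>z\<in>topspace (snd Y).
        (\<forall>x\<in>topspace (snd Y). \<not> openin (snd Y) {x} \<longleftrightarrow> x = z) \<and>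
        (\<forall>x\<in>topspace (snd Y). fst Y z x = z \<and> fst Y x z = z))"

text \<open>A class \<open>\<C>\<close> of topological semigroups is represented by those of its members whose carrier
  is a subset of a universe type \<open>'b\<close>. The type should be large: once it has at least
  continuum many elements, it contains copies of all Polish semigroups and of all
  \<open>0\<close>-discrete semigroups of cardinality at most the continuum. A semigroup with a separable
  metric is itself of cardinality at most the continuum.\<close>

definition injectively_closed ::
  "'b topsemi set \<Rightarrow> 'a set \<Rightarrow> ('a \<Rightarrow> 'a \<Rightarrow> 'a) \<Rightarrow> bool" where
  "injectively_closed \<C> S m \<longleftrightarrow>
     (\<forall>Y\<in>\<C>. \<forall>h. h \<in> S \<rightarrow> topspace (snd Y) \<and> inj_on h S \<and>
        (\<forall>x\<in>S. \<forall>y\<in>S. h (m x y) = fst Y (h x) (h y)) \<longrightarrow> closedin (snd Y) (h ` S))"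

section \<open>The covering number of the meager ideal\<close>

definition nowhere_dense :: "'a::topological_space set \<Rightarrow> bool" where
  "nowhere_dense A \<longleftrightarrow> interior (closure A) = {}"

definition meager :: "'a::topological_space set \<Rightarrow> bool" where
  "meager A \<longleftrightarrow> (\<exists>N :: nat \<Rightarrow> 'a set. (\<forall>n. nowhere_dense (N n)) \<and> A = (\<Union>n. N n))"

definition meager_cover :: "real set set \<Rightarrow> bool" where
  "meager_cover F \<longleftrightarrow> (\<forall>A\<in>F. meager A) \<and> \<Union>F = UNIV"

definition cov_meager :: "real set rel" where
  "cov_meager = (SOME r. \<exists>F. meager_cover F \<and> r = |F| \<and> (\<forall>G. meager_cover G \<longrightarrow> |F| \<le>o |G| ))"

text \<open>The choice is well-defined up to \<open>=o\<close>, since a cover of least cardinality exists.\<close>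

lemma cov_meager:
  "\<exists>F. meager_cover F \<and> cov_meager = |F| \<and> (\<forall>G. meager_cover G \<longrightarrow> |F| \<le>o |G| )"
proof -
  have "nowhere_dense {x}" for x :: real
    by (simp add: nowhere_dense_def)
  then have "meager {x}" for x :: real
    unfolding meager_def by (intro exI[of _ "\<lambda>_. {x}"]) auto
  then have "meager_cover (range (\<lambda>x. {x}))"
    by (auto simp: meager_cover_def)
  then have "card_of ` Collect meager_cover \<noteq> {}"
    by blast
  then have "\<exists>r \<in> card_of ` Collect meager_cover. \<forall>r' \<in> card_of ` Collect meager_cover. r \<le>o r'"
    by (rule exists_minim_Card_order) (auto simp: card_of_Card_order)
  then have "\<exists>r F. meager_cover F \<and> r = |F| \<and> (\<forall>G. meager_cover G \<longrightarrow> |F| \<le>o |G| )"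
    by auto
  then show ?thesis
    unfolding cov_meager_def by (rule someI_ex)
qed

end

theory Submission
  imports Defs
begin

text \<open>
  The hypothesis on \<open>0\<close>-discrete semigroups makes \<open>S\<close> zero-closed
  (\<open>injectively_closed_imp_zero_closed\<close>): whenever a family of nonempty subsets of \<open>S\<close> behaves like the
  traces of the neighbourhoods of a zero adjoined to \<open>S\<close>, it has a common point. The hypothesis on Polish
  semigroups makes the given metric complete, since \<open>S\<close> is closed in its completion
  (\<open>injectively_closed_imp_mcomplete\<close>). Zero-closedness is then applied to three families.

  First, the nonempty two-sided ideals have a common point, so \<open>S\<close> has a minimal ideal \<open>K\<close>, and
  every \<open>k \<in> K\<close> can be written as \<open>u y v\<close> for any given \<open>y\<close>.

  Second, some semigroup polynomial is constant on the part of \<open>K\<close> near some point \<open>x0\<close> of \<open>K\<close>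
  (\<open>word_constant_near_min_ideal\<close>). Otherwise algebraic sets would be closed with nowhere dense
  trace on \<open>K\<close>, and as \<open>cov(\<M>)\<close> is the continuum, fewer than continuum many of them would not cover \<open>S\<close>
  (\<open>generic_point\<close>). A transfinite recursion could then choose points outside all
  algebraic sets with coefficients chosen before, and the products involving late points would form a
  forbidden family (\<open>zero_closed_covered_by_small_family\<close>).

  Third, for every \<open>\<epsilon> > 0\<close> there are finitely many polynomials such that every point of \<open>S\<close>
  is mapped into the \<open>\<epsilon>\<close>-ball around \<open>x0\<close> by one of them
  (\<open>zero_closed_finitely_many_words_near\<close>). This is again shown by constructing a
  forbidden family, now from a sequence of points. Only finitely many polynomials can be avoided in
  each step, so coefficients are replaced by members of a dense sequence; subinvariance makes the
  resulting errors additive, and they are kept below \<open>\<epsilon>\<close> by assigning tolerances.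

  Composing the polynomial that is constant near \<open>x0\<close> with these finitely many polynomials, whose values
  can be moved into \<open>K\<close>, gives finitely many algebraic sets that cover \<open>S\<close>.
\<close>

section \<open>Zero-closed semigroups\<close>

locale carrier_semigroup =
  fixes S :: "'a set" and m :: "'a \<Rightarrow> 'a \<Rightarrow> 'a"
  assumes semigroup: "semigroup_on S m"
begin

lemma m_closed [simp, intro]: "x \<in> S \<Longrightarrow> y \<in> S \<Longrightarrow> m x y \<in> S"
  using semigroup by (simp add: semigroup_on_def)

lemma m_assoc: "x \<in> S \<Longrightarrow> y \<in> S \<Longrightarrow> z \<in> S \<Longrightarrow> m (m x y) z = m x (m y z)"
  using semigroup by (simp add: semigroup_on_def)

end

text \<open>The sets \<open>\<U>\<close> are the traces on \<open>S\<close> of the neighbourhoods of \<open>0\<close> in the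
semigroup \<open>S \<union> {0}\<close>, whose points of \<open>S\<close> are isolated. The three closure
conditions say that \<open>\<U>\<close> is a filter base, that multiplication is continuous at
\<open>(x, 0)\<close> and \<open>(0, x)\<close>, and that it is continuous at \<open>(0, 0)\<close>; since the members are
nonempty, \<open>0\<close> is not isolated. The topology is Hausdorff when \<open>\<U>\<close> has no common point, so the
definition forbids that \<open>S\<close> is a non-closed subset of a Hausdorff \<open>0\<close>-discrete
semigroup \<open>S \<union> {0}\<close>.\<close>

definition zero_closed :: "'a set \<Rightarrow> ('a \<Rightarrow> 'a \<Rightarrow> 'a) \<Rightarrow> bool" where
  "zero_closed S m \<longleftrightarrow>
     (\<forall>\<U>. \<U> \<noteq> {} \<longrightarrow> (\<forall>U\<in>\<U>. U \<subseteq> S \<and> U \<noteq> {}) \<longrightarrow>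
        (\<forall>U\<in>\<U>. \<forall>V\<in>\<U>. \<exists>W\<in>\<U>. W \<subseteq> U \<inter> V) \<longrightarrow>
        (\<forall>U\<in>\<U>. \<forall>x\<in>S. \<exists>V\<in>\<U>. \<forall>y\<in>V. m x y \<in> U \<and> m y x \<in> U) \<longrightarrow>
        (\<forall>U\<in>\<U>. \<exists>V\<in>\<U>. \<forall>y\<in>V. \<forall>w\<in>V. m y w \<in> U) \<longrightarrow>
        (\<exists>x\<in>S. \<forall>U\<in>\<U>. x \<in> U))"

text \<open>A family without a common point would define a Hausdorff \<open>0\<close>-discrete topological semigroup on
\<open>S \<union> {0}\<close> in which \<open>S\<close> is not closed. The cardinality bounds serve to copy \<open>S \<union> {0}\<close> into the
universe type.\<close>

lemma injectively_closed_imp_zero_closed: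
  fixes \<C> :: "'b topsemi set"
  assumes big: "|UNIV :: real set| \<le>o |UNIV :: 'b set|" and small: "|S| \<le>o |UNIV :: real set|"
    and \<C>: "\<forall>Y :: 'b topsemi. zero_discrete_semigroup Y \<and> Hausdorff_space (snd Y) \<longrightarrow> Y \<in> \<C>"
    and S: "semigroup_on S m" and closed: "injectively_closed \<C> S m"
  shows "zero_closed S m"
  unfolding zero_closed_def
proof (intro allI impI, rule ccontr)
  fix \<U>
  assume ne: "\<U> \<noteq> {}" and U: "\<forall>U\<in>\<U>. U \<subseteq> S \<and> U \<noteq> {}"
    and dir: "\<forall>U\<in>\<U>. \<forall>V\<in>\<U>. \<exists>W\<in>\<U>. W \<subseteq> U \<inter> V"
    and mx: "\<forall>U\<in>\<U>. \<forall>x\<in>S. \<exists>V\<in>\<U>. \<forall>y\<in>V. m x y \<in> U \<and> m y x \<in> U"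
    and mm: "\<forall>U\<in>\<U>. \<exists>V\<in>\<U>. \<forall>y\<in>V. \<forall>w\<in>V. m y w \<in> U"
    and no: "\<not> (\<exists>x\<in>S. \<forall>U\<in>\<U>. x \<in> U)"
  have sep: "\<exists>U\<in>\<U>. x \<notin> U" if "x \<in> S" for x
    using no that by blast
  from big obtain i :: "real \<Rightarrow> 'b" where i: "inj i"
    unfolding card_of_ordLeq[symmetric] by auto
  from small obtain j :: "'a \<Rightarrow> real" where j: "inj_on j S"
    unfolding card_of_ordLeq[symmetric] by auto
  \<comment> \<open>The values of \<open>exp\<close> are positive, which leaves the image of \<open>0\<close> free for the new zero.\<close>
  define g where "g x = i (exp (j x))" for x
  define z where "z = i 0"
  have g: "inj_on g S"
    using i j by (auto simp: g_def inj_on_def inj_def)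
  have gz: "g x \<noteq> z" for x
    using i exp_not_eq_zero by (metis g_def z_def injD)
  define h where "h = inv_into S g"
  have hg: "h (g x) = x" if "x \<in> S" for x
    using that g by (simp add: h_def)
  define Y where "Y = insert z (g ` S)"
  define mul where "mul a b = (if a = z \<or> b = z then z else g (m (h a) (h b)))" for a b
  define T where "T = topology (\<lambda>A. A \<subseteq> Y \<and> (z \<in> A \<longrightarrow> (\<exists>U\<in>\<U>. g ` U \<subseteq> A)))"
  have "istopology (\<lambda>A. A \<subseteq> Y \<and> (z \<in> A \<longrightarrow> (\<exists>U\<in>\<U>. g ` U \<subseteq> A)))"
    unfolding istopology_def
  proof (intro conjI allI impI)
    fix A B
    assume A: "A \<subseteq> Y \<and> (z \<in> A \<longrightarrow> (\<exists>U\<in>\<U>. g ` U \<subseteq> A))"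
      and B: "B \<subseteq> Y \<and> (z \<in> B \<longrightarrow> (\<exists>U\<in>\<U>. g ` U \<subseteq> B))"
    from A show "A \<inter> B \<subseteq> Y" by (simp add: le_infI1)
    assume z: "z \<in> A \<inter> B"
    with A obtain U where U': "U \<in> \<U>" "g ` U \<subseteq> A" by auto
    from z B obtain V where V': "V \<in> \<U>" "g ` V \<subseteq> B" by auto
    from bspec[OF bspec[OF dir U'(1)] V'(1)]
    obtain W where "W \<in> \<U>" "W \<subseteq> U \<inter> V" by auto
    with U' V' show "\<exists>U\<in>\<U>. g ` U \<subseteq> A \<inter> B"
      by (intro bexI[of _ W]) (auto simp: image_subset_iff subset_eq)
  next
    fix \<K>
    assume K: "\<forall>A\<in>\<K>. A \<subseteq> Y \<and> (z \<in> A \<longrightarrow> (\<exists>U\<in>\<U>. g ` U \<subseteq> A))"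
    then show "\<Union> \<K> \<subseteq> Y" by auto
    assume "z \<in> \<Union> \<K>"
    then obtain A where A: "A \<in> \<K>" "z \<in> A" by auto
    from bspec[OF K A(1)] A(2) obtain U where "U \<in> \<U>" "g ` U \<subseteq> A" by auto
    with A show "\<exists>U\<in>\<U>. g ` U \<subseteq> \<Union> \<K>" by (intro bexI[of _ U]) auto
  qed
  then have op: "openin T A \<longleftrightarrow> A \<subseteq> Y \<and> (z \<in> A \<longrightarrow> (\<exists>U\<in>\<U>. g ` U \<subseteq> A))" for A
    by (simp add: T_def topology_inverse')
  have US: "U \<subseteq> S" "U \<noteq> {}" "g ` U \<subseteq> Y" if "U \<in> \<U>" for U
    using bspec[OF U that] by (auto simp: Y_def)
  have "openin T Y"
    using ne US(3) by (auto simp: op)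
  then have topT: "topspace T = Y"
    by (metis op openin_subset openin_topspace subset_antisym)
  have sing: "openin T {g x}" if "x \<in> S" for x
    using that gz by (auto simp: op Y_def)
  have nbh: "openin T (insert z (g ` U))" if "U \<in> \<U>" for U
    using that US(3)[OF that] by (auto simp: op Y_def intro!: bexI[of _ U])
  have nz: "\<not> openin T {z}"
  proof
    assume "openin T {z}"
    then obtain V where "V \<in> \<U>" "g ` V \<subseteq> {z}"
      by (auto simp: op)
    with US(2) gz show False by (meson all_not_in_conv imageI singletonD subsetD)
  qed
  interpret carrier_semigroup S m
    by unfold_locales (rule S)
  have mulg: "mul (g x) (g y) = g (m x y)" if "x \<in> S" "y \<in> S" for x y
    using that by (simp add: mul_def gz hg)
  have mulz: "mul z a = z" "mul a z = z" for a
    by (simp_all add: mul_def)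
  have semi: "semigroup_on Y mul"
    unfolding semigroup_on_def
  proof (intro conjI ballI)
    fix a b assume "a \<in> Y" "b \<in> Y"
    then show "mul a b \<in> Y"
      by (auto simp: Y_def mulz mulg)
  next
    fix a b c assume "a \<in> Y" "b \<in> Y" "c \<in> Y"
    then consider "a = z \<or> b = z \<or> c = z"
      | x y w where "x \<in> S" "y \<in> S" "w \<in> S" "a = g x" "b = g y" "c = g w"
      by (auto simp: Y_def)
    then show "mul (mul a b) c = mul a (mul b c)"
    proof cases
      case 1
      then show ?thesis by (elim disjE) (simp_all add: mulz)
    next
      case 2
      then show ?thesis by (simp add: mulg m_assoc)
    qed
  qed
  have cont: "continuous_map (prod_topology T T) T (\<lambda>(x, y). mul x y)"
    unfolding continuous_map
  proof (intro conjI allI impI)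
    show "(\<lambda>(x, y). mul x y) ` topspace (prod_topology T T) \<subseteq> topspace T"
      using semi by (auto simp: topT semigroup_on_def)
    fix A
    assume A: "openin T A"
    show "openin (prod_topology T T) {p \<in> topspace (prod_topology T T). (case p of (x, y) \<Rightarrow> mul x y) \<in> A}"
      unfolding openin_prod_topology_alt
    proof (intro allI impI)
      fix a b
      assume "(a, b) \<in> {p \<in> topspace (prod_topology T T). (case p of (x, y) \<Rightarrow> mul x y) \<in> A}"
      then have ab: "a \<in> Y" "b \<in> Y" "mul a b \<in> A"
        by (auto simp: topT)
      let ?P = "{p \<in> topspace (prod_topology T T). (case p of (x, y) \<Rightarrow> mul x y) \<in> A}"
      have P: "P \<times> Q \<subseteq> ?P"
        if "openin T P" "openin T Q" and PQ: "\<And>a b. a \<in> P \<Longrightarrow> b \<in> Q \<Longrightarrow> mul a b \<in> A" for P Q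
      proof -
        have "P \<subseteq> Y" "Q \<subseteq> Y"
          using that(1,2) by (simp_all add: op)
        with PQ show ?thesis
          by (auto simp: topT)
      qed
      consider (gg) x y where "x \<in> S" "y \<in> S" "a = g x" "b = g y"
        | (gz) x where "x \<in> S" "a = g x" "b = z" | (zg) x where "x \<in> S" "a = z" "b = g x"
        | (zz) "a = z" "b = z"
        using ab by (auto simp: Y_def)
      then show "\<exists>P Q. openin T P \<and> openin T Q \<and> a \<in> P \<and> b \<in> Q \<and> P \<times> Q \<subseteq> ?P"
      proof cases
        case gg
        have "{a} \<times> {b} \<subseteq> ?P"
          by (rule P) (use gg ab in \<open>simp_all add: sing\<close>)
        then show ?thesis
          using gg sing by blast
      next
        case gz
        with ab have "z \<in> A" by (simp add: mulz)
        with A obtain U where U': "U \<in> \<U>" "g ` U \<subseteq> A" by (auto simp: op)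
        from bspec[OF bspec[OF mx U'(1)] gz(1)]
        obtain V where V: "V \<in> \<U>" "\<forall>y\<in>V. m x y \<in> U \<and> m y x \<in> U" by auto
        have VS: "V \<subseteq> S" by (rule US(1)[OF V(1)])
        have "{g x} \<times> insert z (g ` V) \<subseteq> ?P"
        proof (rule P[OF sing[OF gz(1)] nbh[OF V(1)]])
          fix c e assume "c \<in> {g x}" "e \<in> insert z (g ` V)"
          then show "mul c e \<in> A"
            using V(2) U'(2) VS gz(1) \<open>z \<in> A\<close> by (auto simp: mulz mulg image_subset_iff subset_eq)
        qed
        with sing[OF gz(1)] nbh[OF V(1)] show ?thesis
          unfolding gz(2,3) by blast
      next
        case zg
        with ab have "z \<in> A" by (simp add: mulz)
        with A obtain U where U': "U \<in> \<U>" "g ` U \<subseteq> A" by (auto simp: op)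
        from bspec[OF bspec[OF mx U'(1)] zg(1)]
        obtain V where V: "V \<in> \<U>" "\<forall>y\<in>V. m x y \<in> U \<and> m y x \<in> U" by auto
        have VS: "V \<subseteq> S" by (rule US(1)[OF V(1)])
        have "insert z (g ` V) \<times> {g x} \<subseteq> ?P"
        proof (rule P[OF nbh[OF V(1)] sing[OF zg(1)]])
          fix e c assume "e \<in> insert z (g ` V)" "c \<in> {g x}"
          then show "mul e c \<in> A"
            using V(2) U'(2) VS zg(1) \<open>z \<in> A\<close> by (auto simp: mulz mulg image_subset_iff subset_eq)
        qed
        with sing[OF zg(1)] nbh[OF V(1)] show ?thesis
          unfolding zg(2,3) by blast
      next
        case zz
        with ab have "z \<in> A" by (simp add: mulz)
        with A obtain U where U': "U \<in> \<U>" "g ` U \<subseteq> A" by (auto simp: op)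
        from bspec[OF mm U'(1)] obtain V where V: "V \<in> \<U>" "\<forall>y\<in>V. \<forall>w\<in>V. m y w \<in> U" by auto
        have VS: "V \<subseteq> S" by (rule US(1)[OF V(1)])
        have "insert z (g ` V) \<times> insert z (g ` V) \<subseteq> ?P"
        proof (rule P[OF nbh[OF V(1)] nbh[OF V(1)]])
          fix e c assume "e \<in> insert z (g ` V)" "c \<in> insert z (g ` V)"
          then show "mul e c \<in> A"
            using V(2) U'(2) VS \<open>z \<in> A\<close> by (auto simp: mulz mulg image_subset_iff subset_eq)
        qed
        with nbh[OF V(1)] show ?thesis
          unfolding zz by blast
      qed
    qed
  qed
  have ts: "topological_semigroup (mul, T)"
    using semi cont by (simp add: topological_semigroup_def topT)
  have iso: "\<not> openin T {x} \<longleftrightarrow> x = z" if "x \<in> Y" for x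
    using that sing nz by (auto simp: Y_def)
  have "z \<in> Y" by (simp add: Y_def)
  with ts iso have zd: "zero_discrete_semigroup (mul, T)"
    unfolding zero_discrete_semigroup_def by (intro conjI bexI[of _ z]) (simp_all add: topT mulz)
  have "Hausdorff_space T"
    unfolding Hausdorff_space_def topT
  proof (intro allI impI)
    have gz_sep: "\<exists>P Q. openin T P \<and> openin T Q \<and> g x \<in> P \<and> z \<in> Q \<and> disjnt P Q" if x: "x \<in> S" for x
    proof -
      obtain U' where U': "U' \<in> \<U>" "x \<notin> U'" using sep x by blast
      then have "g x \<notin> g ` U'"
        using US(1)[OF U'(1)] g x by (metis inj_on_image_mem_iff)
      with U' x show ?thesis
        by (intro exI[of _ "{g x}"] exI[of _ "insert z (g ` U')"]) (use gz[of x] in \<open>simp add: sing nbh\<close>)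
    qed
    fix a b
    assume "a \<in> Y \<and> b \<in> Y \<and> a \<noteq> b"
    then consider x y where "x \<in> S" "y \<in> S" "a = g x" "b = g y" "a \<noteq> b"
      | x where "x \<in> S" "a = g x" "b = z" | x where "x \<in> S" "a = z" "b = g x"
      by (auto simp: Y_def)
    then show "\<exists>P Q. openin T P \<and> openin T Q \<and> a \<in> P \<and> b \<in> Q \<and> disjnt P Q"
    proof cases
      case 1
      then show ?thesis
        by (intro exI[of _ "{a}"] exI[of _ "{b}"]) (auto simp: sing)
    next
      case 2 with gz_sep show ?thesis by blast
    next
      case 3 with gz_sep show ?thesis by (meson disjnt_sym)
    qed
  qed
  with zd \<C> have "(mul, T) \<in> \<C>" by simp
  moreover have "g \<in> S \<rightarrow> topspace T"
    by (auto simp: topT Y_def)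
  moreover have "\<forall>x\<in>S. \<forall>y\<in>S. g (m x y) = mul (g x) (g y)"
    by (simp add: mulg)
  ultimately have "closedin T (g ` S)"
    using closed[unfolded injectively_closed_def, rule_format, of "(mul, T)" g] g by simp
  then have "openin T (Y - g ` S)"
    by (simp add: closedin_def topT)
  moreover have "Y - g ` S = {z}"
    using gz by (auto simp: Y_def)
  ultimately show False
    using nz by simp
qed

lemma zero_closedD:
  assumes "zero_closed S m" "\<U> \<noteq> {}" "\<And>U. U \<in> \<U> \<Longrightarrow> U \<subseteq> S" "\<And>U. U \<in> \<U> \<Longrightarrow> U \<noteq> {}"
    and "\<And>U V. U \<in> \<U> \<Longrightarrow> V \<in> \<U> \<Longrightarrow> \<exists>W\<in>\<U>. W \<subseteq> U \<inter> V"
    and "\<And>U x. U \<in> \<U> \<Longrightarrow> x \<in> S \<Longrightarrow> \<exists>V\<in>\<U>. \<forall>y\<in>V. m x y \<in> U \<and> m y x \<in> U"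
    and "\<And>U. U \<in> \<U> \<Longrightarrow> \<exists>V\<in>\<U>. \<forall>y\<in>V. \<forall>w\<in>V. m y w \<in> U"
  obtains x where "x \<in> S" "\<And>U. U \<in> \<U> \<Longrightarrow> x \<in> U"
proof -
  have "\<exists>x\<in>S. \<forall>U\<in>\<U>. x \<in> U"
    by (rule assms(1)[unfolded zero_closed_def, THEN spec, THEN mp, THEN mp, THEN mp, THEN mp,
            THEN mp, OF assms(2)]) (use assms in \<open>simp_all del: Int_subset_iff le_inf_iff\<close>)
  with that show thesis by blast
qed

section \<open>The minimal ideal\<close>

text \<open>If \<open>S\<close> has a smallest nonempty two-sided ideal, it is this set: it lies in every ideal \<open>S y S\<close>, and
every nonempty ideal contains some \<open>S y S\<close>.\<close>

definition min_ideal :: "'a set \<Rightarrow> ('a \<Rightarrow> 'a \<Rightarrow> 'a) \<Rightarrow> 'a set" where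
  "min_ideal S m = {k \<in> S. \<forall>y\<in>S. \<exists>u\<in>S. \<exists>v\<in>S. k = m (m u y) v}"

lemma min_ideal_subset: "min_ideal S m \<subseteq> S"
  by (auto simp: min_ideal_def)

context carrier_semigroup
begin

lemma min_ideal_mult:
  assumes k: "k \<in> min_ideal S m" and x: "x \<in> S"
  shows "m x k \<in> min_ideal S m" "m k x \<in> min_ideal S m"
proof -
  have "(\<exists>u\<in>S. \<exists>v\<in>S. m x k = m (m u y) v) \<and> (\<exists>u\<in>S. \<exists>v\<in>S. m k x = m (m u y) v)"
    if y: "y \<in> S" for y
  proof -
    obtain u v where uv: "u \<in> S" "v \<in> S" "k = m (m u y) v"
      using k y by (auto simp: min_ideal_def)
    have "m x k = m (m (m x u) y) v" "m k x = m (m u y) (m v x)"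
      unfolding uv(3) using uv(1,2) x y by (simp_all add: m_assoc)
    with uv(1,2) x show ?thesis by blast
  qed
  with k x show "m x k \<in> min_ideal S m" "m k x \<in> min_ideal S m"
    by (auto simp: min_ideal_def)
qed

text \<open>The nonempty ideals satisfy all conditions on traces of neighbourhoods of \<open>0\<close>: two ideals meet in the
products of their elements, and an ideal absorbs products. So they have a common point.\<close>

lemma zero_closed_min_ideal_nonempty:
  assumes zc: "zero_closed S m" and "S \<noteq> {}"
  shows "min_ideal S m \<noteq> {}"
proof -
  define \<I> where "\<I> = {I. I \<subseteq> S \<and> I \<noteq> {} \<and> (\<forall>x\<in>S. \<forall>y\<in>I. m x y \<in> I \<and> m y x \<in> I)}"
  have S\<I>: "S \<in> \<I>" using assms by (auto simp: \<I>_def)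
  obtain e where e: "e \<in> S" "\<And>I. I \<in> \<I> \<Longrightarrow> e \<in> I"
  proof (rule zero_closedD[OF zc])
    show "\<I> \<noteq> {}" using S\<I> by blast
    show "\<exists>W\<in>\<I>. W \<subseteq> U \<inter> V" if "U \<in> \<I>" "V \<in> \<I>" for U V
    proof
      have "U \<noteq> {}" "V \<noteq> {}" using that by (simp_all add: \<I>_def)
      then obtain u v where "u \<in> U" "v \<in> V" by blast
      with that have "m u v \<in> U \<inter> V" by (auto simp: \<I>_def subset_eq)
      with that show "U \<inter> V \<in> \<I>" unfolding \<I>_def by blast
    qed auto
    show "\<exists>V\<in>\<I>. \<forall>y\<in>V. m x y \<in> U \<and> m y x \<in> U" if "U \<in> \<I>" "x \<in> S" for U x
      using that by (intro bexI[of _ U]) (auto simp: \<I>_def)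
    show "\<exists>V\<in>\<I>. \<forall>y\<in>V. \<forall>w\<in>V. m y w \<in> U" if "U \<in> \<I>" for U
      using that by (intro bexI[of _ U]) (auto simp: \<I>_def subset_eq)
  qed (auto simp: \<I>_def)
  have "\<exists>u\<in>S. \<exists>v\<in>S. e = m (m u y) v" if y: "y \<in> S" for y
  proof -
    define J where "J = {m (m u y) v | u v. u \<in> S \<and> v \<in> S}"
    have "m x a \<in> J \<and> m a x \<in> J" if x: "x \<in> S" and "a \<in> J" for x a
    proof -
      from \<open>a \<in> J\<close> obtain u v where uv: "u \<in> S" "v \<in> S" "a = m (m u y) v"
        by (auto simp: J_def)
      have "m x a = m (m (m x u) y) v" "m a x = m (m u y) (m v x)"
        unfolding uv(3) using uv(1,2) x y by (simp_all add: m_assoc)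
      with uv(1,2) x show ?thesis unfolding J_def by blast
    qed
    moreover have "J \<subseteq> S" "J \<noteq> {}"
      using y \<open>S \<noteq> {}\<close> by (auto simp: J_def)
    ultimately have "J \<in> \<I>"
      by (simp add: \<I>_def)
    with e have "e \<in> J" by blast
    then show ?thesis by (auto simp: J_def)
  qed
  with e show ?thesis by (auto simp: min_ideal_def)
qed

end

section \<open>Semigroup polynomials\<close>

text \<open>A semigroup need not have a unit, so the product is meaningful for nonempty lists only.\<close>

fun prodl :: "('a \<Rightarrow> 'a \<Rightarrow> 'a) \<Rightarrow> 'a list \<Rightarrow> 'a" where
  "prodl m [] = undefined"
| "prodl m [x] = x"
| "prodl m (x # y # xs) = m x (prodl m (y # xs))"

lemma prodl_Cons: "xs \<noteq> [] \<Longrightarrow> prodl m (x # xs) = m x (prodl m xs)"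
  by (cases xs) simp_all

text \<open>A semigroup polynomial \<open>a\<^sub>0 x a\<^sub>1 x \<dots> x a\<^sub>n\<close> is written as the list of its letters, where
\<^const>\<open>None\<close> stands for the variable \<open>x\<close> and missing coefficients are simply omitted.\<close>

definition subst_word :: "'a option list \<Rightarrow> 'a \<Rightarrow> 'a list" where
  "subst_word l x = map (case_option x (\<lambda>c. c)) l"

lemma subst_word_simps [simp]:
  "subst_word [] x = []" "subst_word (None # l) x = x # subst_word l x"
  "subst_word (Some c # l) x = c # subst_word l x"
  "subst_word (l @ l') x = subst_word l x @ subst_word l' x"
  "length (subst_word l x) = length l" "subst_word l x = [] \<longleftrightarrow> l = []"
  by (simp_all add: subst_word_def)

text \<open>Words contain the variable at least once; this corresponds to the condition \<open>n \<ge> 1\<close> on algebraic sets.\<close>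

definition words :: "'a set \<Rightarrow> 'a option list set" where
  "words C = {l. set l \<subseteq> insert None (Some ` C) \<and> None \<in> set l}"

lemma words_mono: "C \<subseteq> D \<Longrightarrow> words C \<subseteq> words D"
  unfolding words_def by blast

lemma words_ne: "l \<in> words C \<Longrightarrow> l \<noteq> []"
  by (auto simp: words_def)

lemma subst_word_subset:
  assumes "l \<in> words C"
  shows "set (subst_word l x) \<subseteq> insert x C"
  using assms by (auto simp: words_def subst_word_def split: option.splits)

text \<open>A product in which \<open>z\<close> occurs is the value at \<open>z\<close> of a word, obtained by reading every
occurrence of \<open>z\<close> as the variable.\<close>

lemma word_of_list:
  assumes "set xs \<subseteq> insert z C" "z \<in> set xs"
  obtains l where "l \<in> words C" "subst_word l z = xs" "length l = length xs"
proof
  define l where "l = map (\<lambda>x. if x = z then None else Some x) xs"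
  show "l \<in> words C"
    using assms by (auto simp: words_def l_def image_iff)
  show "subst_word l z = xs"
    by (auto simp: subst_word_def l_def intro!: map_idI)
  show "length l = length xs" by (simp add: l_def)
qed

definition compose_word :: "'a option list \<Rightarrow> 'a option list \<Rightarrow> 'a option list" where
  "compose_word l l' = concat (map (\<lambda>q. case q of None \<Rightarrow> l' | Some c \<Rightarrow> [Some c]) l)"

lemma compose_word_words:
  assumes "l \<in> words C" "l' \<in> words C"
  shows "compose_word l l' \<in> words C"
  using assms by (auto simp: compose_word_def words_def subset_iff split: option.splits)

context carrier_semigroup
begin

lemma prodl_closed: "xs \<noteq> [] \<Longrightarrow> set xs \<subseteq> S \<Longrightarrow> prodl m xs \<in> S"
  by (induction xs rule: induct_list012) auto

lemma prodl_append:
  "xs \<noteq> [] \<Longrightarrow> ys \<noteq> [] \<Longrightarrow> set xs \<subseteq> S \<Longrightarrow> set ys \<subseteq> S \<Longrightarrow>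
    prodl m (xs @ ys) = m (prodl m xs) (prodl m ys)"
  by (induction xs rule: induct_list012) (auto simp: prodl_Cons m_assoc prodl_closed)

lemma word_closed: "l \<in> words S \<Longrightarrow> x \<in> S \<Longrightarrow> prodl m (subst_word l x) \<in> S"
  using subst_word_subset[of l S x] words_ne[of l S] by (intro prodl_closed) auto

lemma mult1_closed: "a \<in> carrier1 S \<Longrightarrow> b \<in> carrier1 S \<Longrightarrow> mult1 m a b \<in> carrier1 S"
  by (auto simp: carrier1_def)

lemma mult1_assoc:
  "a \<in> carrier1 S \<Longrightarrow> b \<in> carrier1 S \<Longrightarrow> c \<in> carrier1 S \<Longrightarrow>
    mult1 m (mult1 m a b) c = mult1 m a (mult1 m b c)"
  by (auto simp: carrier1_def m_assoc)

lemma mult1_None [simp]: "mult1 m a None = a"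
  by (cases a) auto

lemma word_eval_closed:
  assumes "\<forall>i\<le>n. a i \<in> carrier1 S" "x \<in> S"
  shows "word_eval m a n x \<in> carrier1 S"
  using assms(1)
proof (induction n)
  case (Suc n)
  then show ?case
    using \<open>x \<in> S\<close> by (auto intro!: mult1_closed simp: carrier1_def)
qed auto

lemma word_eval_cong: "(\<And>i. i \<le> n \<Longrightarrow> a i = b i) \<Longrightarrow> word_eval m a n x = word_eval m b n x"
  by (induction n) auto

lemma word_eval_upd_last:
  assumes a: "\<forall>i\<le>n. a i \<in> carrier1 S" and c: "c \<in> carrier1 S" and x: "x \<in> S"
  shows "word_eval m (a(n := mult1 m (a n) c)) n x = mult1 m (word_eval m a n x) c"
proof (cases n)
  case (Suc k)
  have "word_eval m (a(n := mult1 m (a n) c)) k x = word_eval m a k x"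
    by (rule word_eval_cong) (use Suc in auto)
  moreover have "word_eval m a k x \<in> carrier1 S"
    using word_eval_closed[of k a x] a x Suc by auto
  moreover have "Some x \<in> carrier1 S"
    using x by (simp add: carrier1_def)
  ultimately show ?thesis
    using Suc a c by (simp add: mult1_assoc mult1_closed)
qed simp

text \<open>The word is read from left to right. A variable letter adds a new factor and the trivial last
coefficient; a constant letter is multiplied into the last coefficient. A word without variable is
needed on the way, whence the conditional bound on \<open>n\<close>.\<close>

lemma word_eval_word:
  assumes "l \<noteq> []" "set l \<subseteq> insert None (Some ` S)"
  shows "\<exists>n a. (None \<in> set l \<longrightarrow> n \<ge> 1) \<and> (\<forall>i\<le>n. a i \<in> carrier1 S) \<and>
           (\<forall>x\<in>S. word_eval m a n x = Some (prodl m (subst_word l x)))"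
  using assms
proof (induction l rule: rev_nonempty_induct)
  case (single q)
  show ?case
  proof (cases q)
    case None
    then show ?thesis
      by (intro exI[of _ 1] exI[of _ "\<lambda>_. None"]) (auto simp: carrier1_def)
  next
    case (Some c)
    with single show ?thesis
      by (intro exI[of _ 0] exI[of _ "\<lambda>_. Some c"]) (auto simp: carrier1_def)
  qed
next
  case (snoc q l)
  then obtain n a where na: "None \<in> set l \<longrightarrow> n \<ge> 1" "\<forall>i\<le>n. a i \<in> carrier1 S"
    "\<forall>x\<in>S. word_eval m a n x = Some (prodl m (subst_word l x))" by auto
  have sub: "set (subst_word l x) \<subseteq> S" if "x \<in> S" for x
    using snoc.prems that by (auto simp: subst_word_def split: option.splits)
  show ?case
  proof (cases q)
    case None
    have "word_eval m (a(Suc n := None)) (Suc n) x = Some (prodl m (subst_word (l @ [q]) x))"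
      if "x \<in> S" for x
    proof -
      have "word_eval m (a(Suc n := None)) n x = word_eval m a n x"
        by (rule word_eval_cong) auto
      then show ?thesis
        using na that None sub[OF that] snoc.hyps by (simp add: prodl_append)
    qed
    moreover have "\<forall>i\<le>Suc n. (a(Suc n := None)) i \<in> carrier1 S"
      using na by (auto simp: le_Suc_eq carrier1_def)
    ultimately show ?thesis
      by (intro exI[of _ "Suc n"] exI[of _ "a(Suc n := None)"])
        (auto simp del: fun_upd_apply word_eval.simps subst_word_simps)
  next
    case (Some c)
    with snoc have c: "c \<in> S" by auto
    then have c1: "Some c \<in> carrier1 S" by (simp add: carrier1_def)
    let ?a = "a(n := mult1 m (a n) (Some c))"
    have "word_eval m ?a n x = Some (prodl m (subst_word (l @ [q]) x))" if "x \<in> S" for x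
      using word_eval_upd_last[OF na(2) c1 that] na(3) that Some sub[OF that] c snoc.hyps
      by (simp add: prodl_append)
    moreover have "\<forall>i\<le>n. ?a i \<in> carrier1 S"
      using na c1 by (auto intro!: mult1_closed)
    ultimately show ?thesis
      using na(1) Some by (intro exI[of _ n] exI[of _ ?a])
        (auto simp del: fun_upd_apply word_eval.simps subst_word_simps)
  qed
qed

lemma algebraic_word:
  assumes l: "l \<in> words S" and b: "b \<in> S"
  shows "algebraic_in S m {x \<in> S. prodl m (subst_word l x) = b}"
proof -
  from word_eval_word[of l] l words_ne[OF l] obtain n a
    where "n \<ge> 1" "\<forall>i\<le>n. a i \<in> carrier1 S"
      and e: "\<forall>x\<in>S. word_eval m a n x = Some (prodl m (subst_word l x))"
    by (auto simp: words_def)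
  moreover from e have "{x \<in> S. prodl m (subst_word l x) = b} = {x \<in> S. word_eval m a n x = Some b}"
    by auto
  ultimately show ?thesis
    using b unfolding algebraic_in_def by blast
qed

lemma polyboundedI:
  assumes "finite F" "\<And>l b. (l, b) \<in> F \<Longrightarrow> l \<in> words S \<and> b \<in> S"
    and "\<And>x. x \<in> S \<Longrightarrow> \<exists>(l, b)\<in>F. prodl m (subst_word l x) = b"
  shows "polybounded S m"
  unfolding polybounded_def
proof (intro exI conjI ballI)
  let ?F = "(\<lambda>(l, b). {x \<in> S. prodl m (subst_word l x) = b}) ` F"
  show "finite ?F" using assms(1) by simp
  show "algebraic_in S m A" if "A \<in> ?F" for A
    using that assms(2) algebraic_word by auto
  show "S = \<Union>?F"
    using assms(3) by fastforce
qed

lemma finite_imp_polybounded: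
  assumes "finite S"
  shows "polybounded S m"
  using assms by (intro polyboundedI[of "(\<lambda>b. ([None], b)) ` S"]) (auto simp: words_def)

lemma prodl_compose_word:
  assumes l: "set l \<subseteq> insert None (Some ` S)" "l \<noteq> []" and l': "l' \<in> words S" and x: "x \<in> S"
  shows "prodl m (subst_word (compose_word l l') x) = prodl m (subst_word l (prodl m (subst_word l' x)))"
  using l
proof (induction l)
  case (Cons q l)
  let ?y = "prodl m (subst_word l' x)"
  have y: "?y \<in> S" using l' x by (rule word_closed)
  define h where "h = (case q of None \<Rightarrow> l' | Some c \<Rightarrow> [Some c])"
  have split: "compose_word (q # l) l' = h @ compose_word l l'"
    by (simp add: compose_word_def h_def)
  have l'S: "set (subst_word l' x) \<subseteq> S"
    using subst_word_subset[OF l', of x] x by auto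
  have h: "prodl m (subst_word h x) = (case q of None \<Rightarrow> ?y | Some c \<Rightarrow> c)" "h \<noteq> []"
    "set (subst_word h x) \<subseteq> S"
    using Cons.prems words_ne[OF l'] l'S by (auto simp: h_def split: option.splits)
  show ?case
  proof (cases "l = []")
    case True
    then show ?thesis
      using h by (simp add: split) (auto simp: compose_word_def subst_word_def split: option.splits)
  next
    case False
    have ne: "compose_word l l' \<noteq> []"
      using False words_ne[OF l'] by (cases l) (auto simp: compose_word_def split: option.splits)
    have sub: "set (subst_word (compose_word l l') x) \<subseteq> S"
    proof -
      have "set (compose_word l l') \<subseteq> insert None (Some ` S)"
      proof -
        have "set (case r of None \<Rightarrow> l' | Some c \<Rightarrow> [Some c]) \<subseteq> insert None (Some ` S)"
          if "r \<in> set l" for r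
          by (cases r) (use that Cons.prems(1) l' in \<open>auto simp: words_def\<close>)
        then show ?thesis
          by (simp add: compose_word_def UN_subset_iff)
      qed
      then show ?thesis
        using x by (auto simp: subst_word_def split: option.splits)
    qed
    have "prodl m (subst_word (compose_word (q # l) l') x)
        = m (prodl m (subst_word h x)) (prodl m (subst_word (compose_word l l') x))"
      unfolding split using h ne sub by (simp add: prodl_append)
    also have "\<dots> = prodl m (subst_word (q # l) ?y)"
      using Cons h(1) False by (cases q) (simp_all add: prodl_Cons)
    finally show ?thesis .
  qed
qed simp

end

section \<open>Sets of cardinality below the continuum\<close>

abbreviation less_than_continuum :: "'x set \<Rightarrow> bool" where
  "less_than_continuum A \<equiv> |A| <o |UNIV :: real set|"

lemma countable_less_than_continuum:
  assumes "countable A"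
  shows "less_than_continuum A"
proof (rule ccontr)
  assume "\<not> less_than_continuum A"
  then have "|UNIV :: real set| \<le>o |A|"
    by (simp add: not_ordLess_iff_ordLeq card_of_Well_order)
  then obtain f :: "real \<Rightarrow> 'a" where "inj f" "range f \<subseteq> A"
    unfolding card_of_ordLeq[symmetric] by auto
  with assms show False
    by (meson countable_image_inj_on countable_subset uncountable_UNIV_real)
qed

lemma less_than_continuum_Un:
  assumes "less_than_continuum A" "less_than_continuum B"
  shows "less_than_continuum (A \<union> B)"
  using assms by (intro card_of_Un_ordLess_infinite) (simp add: infinite_UNIV_char_0)

lemma less_than_continuum_image:
  "less_than_continuum A \<Longrightarrow> less_than_continuum (f ` A)"
  using card_of_image ordLeq_ordLess_trans by blast

lemma less_than_continuum_subset:
  "less_than_continuum B \<Longrightarrow> A \<subseteq> B \<Longrightarrow> less_than_continuum A"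
  using card_of_mono1 ordLeq_ordLess_trans by blast

lemma less_than_continuum_Times:
  assumes "less_than_continuum A" "less_than_continuum B"
  shows "less_than_continuum (A \<times> B)"
proof (cases "finite (A <+> B)")
  case True
  then have "finite (A \<times> B)" by auto
  then show ?thesis
    by (intro countable_less_than_continuum) (rule countable_finite)
next
  case False
  have "|A \<times> B| \<le>o |A <+> B|"
    using False card_of_Plus1[of A B] card_of_Plus2[of B A]
    by (intro card_of_Times_ordLeq_infinite_Field) (simp_all add: Field_card_of card_of_card_order_on card_of_mono1[OF order_refl])
  moreover have "less_than_continuum (A <+> B)"
    using assms by (intro card_of_Plus_ordLess_infinite) (simp_all add: infinite_UNIV_char_0)
  ultimately show ?thesis
    using ordLeq_ordLess_trans by blast
qed

lemma less_than_continuum_lists: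
  assumes A: "less_than_continuum A"
  shows "less_than_continuum (lists A)"
proof (cases "finite A")
  case True
  then show ?thesis
    by (intro countable_less_than_continuum) (simp add: uncountable_infinite countable_finite)
next
  case False
  define L where "L n = {l \<in> lists A. length l = n}" for n
  have "|L n| \<le>o |A|" for n
  proof (induction n)
    case 0
    have "L 0 = {[]}" by (auto simp: L_def)
    with False show ?case
      using card_of_singl_ordLeq[of A] by fastforce
  next
    case (Suc n)
    have "L (Suc n) = (\<lambda>(x, l). x # l) ` (A \<times> L n)"
      by (force simp: L_def length_Suc_conv)
    then have "|L (Suc n)| \<le>o |A \<times> L n|"
      by (simp add: card_of_image)
    also have "|A \<times> L n| \<le>o |A|"
      using False Suc by (intro card_of_Times_ordLeq_infinite_Field) (simp_all add: Field_card_of card_of_card_order_on card_of_mono1[OF order_refl])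
    finally show ?case .
  qed
  then have "|\<Union>n. L n| \<le>o |A|"
    using False by (intro card_of_UNION_ordLeq_infinite) (auto simp: infinite_iff_card_of_nat)
  moreover have "lists A = (\<Union>n. L n)"
    by (auto simp: L_def)
  ultimately show ?thesis
    using A ordLeq_ordLess_trans by auto
qed

section \<open>Generic points\<close>

lemma nowhere_denseI:
  assumes "\<And>U. open U \<Longrightarrow> U \<noteq> {} \<Longrightarrow> \<exists>V\<subseteq>U. open V \<and> V \<noteq> {} \<and> V \<inter> A = {}"
  shows "nowhere_dense A"
  unfolding nowhere_dense_def
proof (rule ccontr)
  assume "interior (closure A) \<noteq> {}"
  then obtain V where V: "V \<subseteq> interior (closure A)" "open V" "V \<noteq> {}" "V \<inter> A = {}"
    using assms[of "interior (closure A)"] by auto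
  then have "V \<inter> closure A = {}"
    by (simp add: open_Int_closure_eq_empty)
  with V show False
    using interior_subset by blast
qed

lemma meager_nowhere_dense: "nowhere_dense A \<Longrightarrow> meager A"
  unfolding meager_def by (intro exI[of _ "\<lambda>_. A"]) auto

lemma cov_meager_cover:
  assumes cov: "cov_meager =o |UNIV :: real set|" and \<D>: "less_than_continuum \<D>"
    and A: "\<And>D. D \<in> \<D> \<Longrightarrow> nowhere_dense (A D :: real set)"
  shows "\<exists>r. \<forall>D\<in>\<D>. r \<notin> A D"
proof (rule ccontr)
  assume "\<not> ?thesis"
  then have "meager_cover (A ` \<D>)"
    using A meager_nowhere_dense by (auto simp: meager_cover_def)
  then have "cov_meager \<le>o |A ` \<D>|"
    using cov_meager by auto
  also have "|A ` \<D>| \<le>o |\<D>|"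
    by (rule card_of_image)
  finally have "cov_meager \<le>o |\<D>|" .
  with cov \<D> show False
    by (meson not_ordLess_ordLeq ordIso_iff_ordLeq ordLeq_transitive)
qed

lemma floor_dyadic:
  assumes "j \<le> n"
  shows "\<lfloor>r * 2 ^ j\<rfloor> = \<lfloor>r * 2 ^ n :: real\<rfloor> div 2 ^ (n - j)"
proof -
  have "(2 :: real) ^ n = 2 ^ j * 2 ^ (n - j)"
    using assms by (simp flip: power_add)
  then have "r * 2 ^ j = r * 2 ^ n / real_of_int (2 ^ (n - j))"
    by simp
  then show ?thesis
    by (simp only: floor_divide_real_eq_div zero_le_power zero_le_numeral)
qed

lemma dyadic_interval_in_open:
  fixes U :: "real set"
  assumes "open U" "U \<noteq> {}"
  obtains n k where "\<And>r. \<lfloor>r * 2 ^ n\<rfloor> = k \<Longrightarrow> r \<in> U"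
proof -
  obtain x e where x: "x \<in> U" "e > 0" "ball x e \<subseteq> U"
    using assms openE by (metis all_not_in_conv)
  obtain n where n: "(1/2) ^ n < e"
    using x(2) real_arch_pow_inv[of e "1/2"] by auto
  have "r \<in> U" if "\<lfloor>r * 2 ^ n\<rfloor> = \<lfloor>x * 2 ^ n\<rfloor>" for r
  proof -
    have "\<bar>r * 2 ^ n - x * 2 ^ n\<bar> < 1"
      using that by linarith
    then have "\<bar>(r - x) * 2 ^ n\<bar> < 1"
      by (simp add: left_diff_distrib)
    then have "\<bar>r - x\<bar> * 2 ^ n < 1"
      by (simp add: abs_mult)
    then have "\<bar>r - x\<bar> < (1/2) ^ n"
      by (simp add: power_one_over field_simps)
    with n have "r \<in> ball x e" by (simp add: dist_real_def)
    with x show ?thesis by blast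
  qed
  then show thesis by (rule that)
qed

text \<open>The hypothesis on \<^const>\<open>cov_meager\<close> concerns the real line only. It is carried over to other spaces
through countable posets: the binary digits of a real \<open>r\<close> select a descending path, where the digit
at position \<open>i\<close> decides whether to move to the \<open>i\<close>-th condition, if that refines the present one.
The reals whose path misses a given dense set form a nowhere dense set, since in every dyadic interval
the next digits can be chosen to enter the dense set.\<close>

lemma generic_path:
  fixes R :: "'p \<Rightarrow> 'p \<Rightarrow> bool"
  assumes cov: "cov_meager =o |UNIV :: real set|" and \<D>: "less_than_continuum \<D>"
    and P: "countable P" "P \<noteq> {}"
    and dense: "\<And>D p. D \<in> \<D> \<Longrightarrow> p \<in> P \<Longrightarrow> \<exists>q\<in>P \<inter> D. R q p"
  obtains \<sigma> :: "nat \<Rightarrow> 'p" where "\<And>i. \<sigma> i \<in> P" "\<And>i. \<sigma> (Suc i) = \<sigma> i \<or> R (\<sigma> (Suc i)) (\<sigma> i)"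
    "\<And>D. D \<in> \<D> \<Longrightarrow> \<exists>i. \<sigma> i \<in> D"
proof -
  \<comment> \<open>Every condition is listed infinitely often, so that it can be entered at arbitrarily late digits.\<close>
  define e where "e i = from_nat_into P (fst (prod_decode i))" for i
  have eP: "e i \<in> P" for i
    unfolding e_def by (rule from_nat_into[OF P(2)])
  have e_surj: "\<exists>i\<ge>n. e i = p" if "p \<in> P" for p n
  proof -
    from from_nat_into_surj[OF P(1) that] obtain j where "from_nat_into P j = p" ..
    then show ?thesis
      by (intro exI[of _ "prod_encode (j, n)"]) (simp add: e_def le_prod_encode_2)
  qed
  define path where "path r = rec_nat (e 0) (\<lambda>i p. if odd \<lfloor>r * 2 ^ Suc i\<rfloor> \<and> R (e i) p then e i else p)"
    for r :: real
  have path_0: "path r 0 = e 0" for r by (simp add: path_def)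
  have path_Suc: "path r (Suc i) =
      (if odd \<lfloor>r * 2 ^ Suc i\<rfloor> \<and> R (e i) (path r i) then e i else path r i)" for r i
    by (simp add: path_def)
  have pathP: "path r i \<in> P" for r i
    by (induction i) (auto simp: path_0 path_Suc eP)
  have path_cong: "path r n = path r' n" if "\<lfloor>r * 2 ^ n\<rfloor> = \<lfloor>r' * 2 ^ n\<rfloor>" for r r' n
  proof -
    have fl: "\<lfloor>r * 2 ^ i\<rfloor> = \<lfloor>r' * 2 ^ i\<rfloor>" if "i \<le> n" for i
      using that \<open>\<lfloor>r * 2 ^ n\<rfloor> = \<lfloor>r' * 2 ^ n\<rfloor>\<close> floor_dyadic[of i n r] floor_dyadic[of i n r'] by simp
    have "i \<le> n \<Longrightarrow> path r i = path r' i" for i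
    proof (induction i)
      case (Suc i)
      then show ?case using fl[of "Suc i"] by (simp add: path_Suc del: power_Suc)
    qed (simp add: path_0)
    then show ?thesis by simp
  qed
  have "nowhere_dense {r. \<forall>i. path r i \<notin> D}" if D: "D \<in> \<D>" for D
  proof (rule nowhere_denseI)
    fix U :: "real set"
    assume "open U" "U \<noteq> {}"
    then obtain n k where nk: "\<And>r. \<lfloor>r * 2 ^ n\<rfloor> = k \<Longrightarrow> r \<in> U"
      by (rule dyadic_interval_in_open) blast
    define q where "q = path (of_int k / 2 ^ n) n"
    have q: "path r n = q" if "\<lfloor>r * 2 ^ n\<rfloor> = k" for r
      unfolding q_def by (rule path_cong) (simp add: that)
    obtain p where p: "p \<in> P" "p \<in> D" "R p q"
      using dense[OF D, of q] pathP by (auto simp: q_def)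
    obtain i where i: "i \<ge> n" "e i = p"
      using e_surj[OF p(1)] by blast
    \<comment> \<open>The binary digits of \<open>K\<close> are those of \<open>k\<close>, then zeros up to position \<open>i\<close>, which keep the path at \<open>q\<close>, and a final one.\<close>
    define K where "K = k * 2 ^ (Suc i - n) + 1"
    have hit: "r \<in> U \<and> path r (Suc i) = p" if r: "\<lfloor>r * 2 ^ Suc i\<rfloor> = K" for r
    proof -
      have fl: "\<lfloor>r * 2 ^ j\<rfloor> = k * 2 ^ (j - n)" if "n \<le> j" "j \<le> i" for j
      proof -
        have "\<lfloor>r * 2 ^ j\<rfloor> = K div 2 ^ (Suc i - j)"
          using floor_dyadic[of j "Suc i" r] that r by simp
        have "(1 :: int) < 2 ^ (Suc i - j)"
          by (rule one_less_power) (use that in simp_all)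
        then have "1 div 2 ^ (Suc i - j) = (0 :: int)"
          by (rule div_pos_pos_trivial[OF zero_le_one])
        note \<open>\<lfloor>r * 2 ^ j\<rfloor> = K div 2 ^ (Suc i - j)\<close>
        also have "K = (k * 2 ^ (j - n)) * 2 ^ (Suc i - j) + 1"
          using that by (simp add: K_def flip: power_add)
        also have "\<dots> div 2 ^ (Suc i - j) = k * 2 ^ (j - n)"
          using \<open>1 div 2 ^ (Suc i - j) = (0 :: int)\<close> by simp
        finally show ?thesis .
      qed
      have "\<lfloor>r * 2 ^ n\<rfloor> = k"
        using fl[of n] i by simp
      have "n \<le> j \<Longrightarrow> j \<le> i \<Longrightarrow> path r j = q" for j
      proof (induction j rule: dec_induct)
        case base
        then show ?case using q \<open>\<lfloor>r * 2 ^ n\<rfloor> = k\<close> by simp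
      next
        case (step j)
        have "even \<lfloor>r * 2 ^ Suc j\<rfloor>"
          using step fl[of "Suc j"] by (simp add: Suc_diff_le)
        with step show ?case by (simp add: path_Suc del: power_Suc)
      qed
      then have "path r i = q" using i by simp
      moreover have "odd \<lfloor>r * 2 ^ Suc i\<rfloor>"
        unfolding r K_def using i by (simp add: Suc_diff_le)
      ultimately have "path r (Suc i) = p"
        using p i by (simp add: path_Suc del: power_Suc)
      with \<open>\<lfloor>r * 2 ^ n\<rfloor> = k\<close> nk show ?thesis by simp
    qed
    define V where "V = {of_int K / 2 ^ Suc i <..< (of_int K + 1) / (2 ^ Suc i :: real)}"
    have V: "\<lfloor>r * 2 ^ Suc i\<rfloor> = K" if "r \<in> V" for r
      using that by (intro floor_unique) (auto simp: V_def field_simps)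
    have "(of_int K + 1/2) / 2 ^ Suc i \<in> V"
      by (simp add: V_def divide_strict_right_mono del: power_Suc)
    then have "open V" "V \<noteq> {}"
      by (auto simp: V_def)
    moreover have "V \<subseteq> U" "V \<inter> {r. \<forall>i. path r i \<notin> D} = {}"
      using V hit p by blast+
    ultimately show "\<exists>V\<subseteq>U. open V \<and> V \<noteq> {} \<and> V \<inter> {r. \<forall>i. path r i \<notin> D} = {}"
      by blast
  qed
  from cov_meager_cover[OF cov \<D>, where A = "\<lambda>D. {r. \<forall>i. path r i \<notin> D}", OF this]
  obtain r where "\<forall>D\<in>\<D>. r \<notin> {r. \<forall>i. path r i \<notin> D}"
    by blast
  moreover have "path r (Suc i) = path r i \<or> R (path r (Suc i)) (path r i)" for i
    by (simp add: path_Suc)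
  ultimately show thesis
    using that[of "path r"] pathP by blast
qed

lemma (in Metric_space) separable_dense_sequence:
  assumes "separable_space mtopology" "M \<noteq> {}"
  obtains s :: "nat \<Rightarrow> 'a" where "\<And>i. s i \<in> M" "\<And>x \<epsilon>. x \<in> M \<Longrightarrow> \<epsilon> > 0 \<Longrightarrow> \<exists>i. d x (s i) < \<epsilon>"
proof -
  obtain C where C: "countable C" "C \<subseteq> M" "mtopology closure_of C = M"
    using assms(1) by (auto simp: separable_space_def)
  have "C \<noteq> {}" using C(3) assms(2) by auto
  show thesis
  proof
    show "from_nat_into C i \<in> M" for i
      using from_nat_into[OF \<open>C \<noteq> {}\<close>] C(2) by blast
    fix x and \<epsilon> :: real
    assume "x \<in> M" "\<epsilon> > 0"
    then have "x \<in> mtopology closure_of C" using C(3) by simp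
    then obtain c where "c \<in> C" "d x c < \<epsilon>"
      using \<open>\<epsilon> > 0\<close> unfolding metric_closure_of by auto
    with from_nat_into_surj[OF C(1)] show "\<exists>i. d x (from_nat_into C i) < \<epsilon>"
      by metis
  qed
qed

text \<open>A form of the Baire category theorem for fewer than continuum many open sets. Conditions are small
balls that meet \<open>K\<close>, centred at points of a dense sequence; along a path that meets all relevant dense
sets the balls shrink to a single point.\<close>

lemma (in Metric_space) generic_point:
  assumes cov: "cov_meager =o |UNIV :: real set|"
    and complete: "mcomplete" and sep: "separable_space mtopology"
    and K: "K \<subseteq> M" "K \<noteq> {}" and \<G>: "less_than_continuum \<G>"
    and op: "\<And>G. G \<in> \<G> \<Longrightarrow> openin mtopology G"
    and dense: "\<And>G x \<epsilon>. G \<in> \<G> \<Longrightarrow> x \<in> K \<Longrightarrow> \<epsilon> > 0 \<Longrightarrow> \<exists>y\<in>K \<inter> G. d x y < \<epsilon>"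
  shows "\<exists>z\<in>M. \<forall>G\<in>\<G>. z \<in> G"
proof -
  have "M \<noteq> {}" using K by blast
  obtain s :: "nat \<Rightarrow> 'a" where s: "\<And>i. s i \<in> M" "\<And>x \<epsilon>. x \<in> M \<Longrightarrow> \<epsilon> > 0 \<Longrightarrow> \<exists>i. d x (s i) < \<epsilon>"
    using separable_dense_sequence[OF sep \<open>M \<noteq> {}\<close>] by blast
  define C where "C = range s"
  have C: "countable C" "C \<subseteq> M" using s(1) by (auto simp: C_def)
  have C_near: "\<exists>c\<in>C. d y c < \<epsilon>" if "y \<in> M" "\<epsilon> > 0" for y \<epsilon>
    using s(2)[OF that] by (simp add: C_def)
  define P where "P = {(x, n :: nat). x \<in> C \<and> mball x ((1/2) ^ n) \<inter> K \<noteq> {}}"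
  define R where "R = (\<lambda>(y, m) (x, n). mcball y ((1/2) ^ m) \<subseteq> mcball x ((1/2) ^ n :: real))"
    for m n :: nat
  have refine: "\<exists>(c, m)\<in>P. m \<ge> N \<and> mcball c ((1/2) ^ m) \<subseteq> mball x ((1/2) ^ n) \<inter> G"
    if p: "(x, n) \<in> P" and G: "openin mtopology G"
      and dG: "\<And>x \<epsilon>. x \<in> K \<Longrightarrow> \<epsilon> > 0 \<Longrightarrow> \<exists>y\<in>K \<inter> G. d x y < \<epsilon>" for x n G N
  proof -
    let ?B = "mball x ((1/2) ^ n)"
    have "?B \<inter> K \<noteq> {}"
      using p by (simp add: P_def)
    then obtain k where k: "k \<in> K" "k \<in> ?B" by blast
    have "openin mtopology ?B" by simp
    with k obtain \<epsilon> where \<epsilon>: "\<epsilon> > 0" "mball k \<epsilon> \<subseteq> ?B"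
      by (meson openin_mtopology)
    with dG k obtain y where y: "y \<in> K" "y \<in> G" "d k y < \<epsilon>" by blast
    then have "y \<in> ?B \<inter> G"
      using \<epsilon> k K by (auto simp: subset_eq)
    moreover have "openin mtopology (?B \<inter> G)"
      using G by (intro openin_Int) auto
    ultimately obtain \<rho> where \<rho>: "\<rho> > 0" "mball y \<rho> \<subseteq> ?B \<inter> G"
      by (meson openin_mtopology)
    obtain j where j: "(1/2) ^ j < \<rho> / 2"
      using \<rho> real_arch_pow_inv[of "\<rho> / 2" "1/2"] by auto
    define m where "m = max j N"
    have "(1/2) ^ m \<le> (1/2 :: real) ^ j"
      by (intro power_decreasing) (auto simp: m_def)
    from this j have m: "(1/2) ^ m < \<rho> / 2" by (rule order_le_less_trans)
    obtain c where c: "c \<in> C" "d y c < (1/2) ^ m"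
      using C_near[of y "(1/2) ^ m"] y K by auto
    have yM: "y \<in> M" and cM: "c \<in> M" using y K c C by auto
    have "y \<in> mball c ((1/2) ^ m)"
      using c yM cM by (simp add: commute)
    with c y have "(c, m) \<in> P" by (auto simp: P_def)
    moreover have "mcball c ((1/2) ^ m) \<subseteq> mball y \<rho>"
      using c m yM by (intro mcball_subset_mball) (auto simp: commute)
    ultimately show ?thesis
      using \<rho> by (intro bexI[of _ "(c, m)"]) (auto simp: m_def)
  qed
  define D where "D G = {(y, m :: nat). mcball y ((1/2) ^ m) \<subseteq> G}" for G
  define D' where "D' N = {(y :: 'a, m :: nat). m \<ge> N}" for N
  have cP: "countable P"
    by (rule countable_subset[of _ "C \<times> UNIV"]) (auto simp: P_def C)
  obtain k where "k \<in> K" using K by blast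
  then obtain c where "c \<in> C" "d k c < 1" using C_near[of k 1] K by auto
  then have "k \<in> mball c ((1/2) ^ 0) \<inter> K"
    using \<open>k \<in> K\<close> K C by (auto simp: commute)
  with \<open>c \<in> C\<close> have "(c, 0) \<in> P" unfolding P_def by blast
  then have neP: "P \<noteq> {}" by blast
  have "less_than_continuum (D ` \<G> \<union> range D')"
    by (intro less_than_continuum_Un less_than_continuum_image[OF \<G>] countable_less_than_continuum) simp
  moreover have "\<exists>q\<in>P \<inter> E. R q p" if E: "E \<in> D ` \<G> \<union> range D'" and p: "p \<in> P" for E p
  proof -
    obtain x n where xn: "p = (x, n)" by fastforce
    from E consider G where "G \<in> \<G>" "E = D G" | N where "E = D' N" by blast
    then show ?thesis
    proof cases
      case 1
      from refine[OF p[unfolded xn] op[OF 1(1)] dense[OF 1(1)], of 0] obtain c m where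
        cm: "(c, m) \<in> P" "mcball c ((1/2) ^ m) \<subseteq> mball x ((1/2) ^ n) \<inter> G" by blast
      from cm(2) mball_subset_mcball[of x "(1/2) ^ n"] have "R (c, m) p"
        unfolding R_def xn by auto
      moreover from cm(2) 1(2) have "(c, m) \<in> E" by (simp add: D_def)
      ultimately show ?thesis using cm(1) by blast
    next
      case 2
      have "\<exists>y\<in>K \<inter> M. d x y < \<epsilon>" if "x \<in> K" "\<epsilon> > 0" for x \<epsilon>
        using that K by (intro bexI[of _ x]) auto
      from refine[OF p[unfolded xn] open_in_mspace this, of N] obtain c m where
        cm: "(c, m) \<in> P" "m \<ge> N" "mcball c ((1/2) ^ m) \<subseteq> mball x ((1/2) ^ n) \<inter> M" by blast
      from cm(3) mball_subset_mcball[of x "(1/2) ^ n"] have "R (c, m) p"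
        unfolding R_def xn by auto
      moreover from cm(2) 2 have "(c, m) \<in> E" by (simp add: D'_def)
      ultimately show ?thesis using cm(1) by blast
    qed
  qed
  ultimately obtain \<sigma> where \<sigma>: "\<And>i. \<sigma> i \<in> P" "\<And>i. \<sigma> (Suc i) = \<sigma> i \<or> R (\<sigma> (Suc i)) (\<sigma> i)"
    "\<And>E. E \<in> D ` \<G> \<union> range D' \<Longrightarrow> \<exists>i. \<sigma> i \<in> E"
    using generic_path[OF cov _ cP neP, of "D ` \<G> \<union> range D'" R] by blast
  define B where "B i = mcball (fst (\<sigma> i)) ((1/2) ^ snd (\<sigma> i))" for i
  have "\<Inter> (range B) \<noteq> {}"
  proof (rule complete[unfolded mcomplete_nest, rule_format], intro conjI allI impI)
    show "closedin mtopology (B i)" for i by (simp add: B_def)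
    show "B i \<noteq> {}" for i
      using \<sigma>(1)[of i] C by (auto simp: B_def P_def mcball_eq_empty split: prod.splits)
    show "decseq B"
    proof (rule decseq_SucI)
      show "B (Suc i) \<subseteq> B i" for i
        using \<sigma>(2)[of i] by (auto simp: B_def R_def split: prod.splits)
    qed
    fix \<epsilon> :: real
    assume "\<epsilon> > 0"
    then obtain N where N: "(1/2) ^ N < \<epsilon>"
      using real_arch_pow_inv[of \<epsilon> "1/2"] by auto
    obtain i where "\<sigma> i \<in> D' N" using \<sigma>(3)[of "D' N"] by blast
    then have "(1/2) ^ snd (\<sigma> i) \<le> (1/2 :: real) ^ N"
      by (intro power_decreasing) (auto simp: D'_def)
    from this N have "(1/2) ^ snd (\<sigma> i) < \<epsilon>"
      by (rule order_le_less_trans)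
    then have "B i \<subseteq> mcball (fst (\<sigma> i)) \<epsilon>"
      unfolding B_def by (intro mcball_subset_concentric) simp
    then show "\<exists>n a. B n \<subseteq> mcball a \<epsilon>" by blast
  qed
  then obtain z where z: "\<And>i. z \<in> B i" by blast
  have "z \<in> G" if G: "G \<in> \<G>" for G
  proof -
    obtain i where "\<sigma> i \<in> D G" using \<sigma>(3)[of "D G"] G by blast
    with z[of i] show ?thesis by (auto simp: D_def B_def)
  qed
  moreover have "z \<in> M" using z[of 0] by (simp add: B_def)
  ultimately show ?thesis by blast
qed

section \<open>Separable metric spaces and their completions\<close>

context Metric_space
begin

lemma separable_spaceI:
  fixes s :: "nat \<Rightarrow> 'a"
  assumes "\<And>i. s i \<in> M" "\<And>x \<epsilon>. x \<in> M \<Longrightarrow> \<epsilon> > 0 \<Longrightarrow> \<exists>i. d x (s i) < \<epsilon>"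
  shows "separable_space mtopology"
  unfolding separable_space_def
proof (intro exI conjI)
  show "countable (range s)" by simp
  show "range s \<subseteq> topspace mtopology" using assms(1) by auto
  show "mtopology closure_of range s = topspace mtopology"
    using assms unfolding metric_closure_of by auto
qed

text \<open>A point is determined by the dyadic balls around the points of a dense sequence that contain it.\<close>

lemma separable_card_le_continuum:
  assumes "separable_space mtopology"
  shows "|M| \<le>o |UNIV :: real set|"
proof (cases "M = {}")
  case False
  then obtain s :: "nat \<Rightarrow> 'a" where s: "\<And>i. s i \<in> M" "\<And>x \<epsilon>. x \<in> M \<Longrightarrow> \<epsilon> > 0 \<Longrightarrow> \<exists>i. d x (s i) < \<epsilon>"
    using separable_dense_sequence[OF assms] by blast
  define F where "F x = {n. d x (s (fst (prod_decode n))) < (1/2) ^ snd (prod_decode n)}" for x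
  have "inj_on F M"
  proof (rule inj_onI, rule ccontr)
    fix x y assume xy: "x \<in> M" "y \<in> M" "F x = F y" "x \<noteq> y"
    then have "d x y / 2 > 0" by simp
    then obtain k where k: "(1/2) ^ k < d x y / 2"
      using real_arch_pow_inv[of "d x y / 2" "1/2"] by auto
    obtain i where i: "d x (s i) < (1/2) ^ k"
      using s(2)[of x "(1/2) ^ k"] xy by auto
    then have "prod_encode (i, k) \<in> F x" by (simp add: F_def)
    with xy have "prod_encode (i, k) \<in> F y" by simp
    then have "d y (s i) < (1/2) ^ k" by (simp add: F_def)
    moreover have "d x y \<le> d x (s i) + d y (s i)"
      using triangle'[of x "s i" y] xy s by simp
    ultimately show False using i k by linarith
  qed
  then have "|M| \<le>o |UNIV :: nat set set|"
    unfolding card_of_ordLeq[symmetric] by blast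
  also have "|UNIV :: nat set set| =o |UNIV :: real set|"
    using nat_sets_eqpoll_reals by (simp add: eqpoll_def card_of_ordIso)
  finally show ?thesis .
qed (simp add: card_of_empty)

end

text \<open>The completion is separable, hence of cardinality at most the continuum, and can be copied into the
universe type.\<close>

lemma (in Metric_space) separable_completion:
  assumes big: "|UNIV :: real set| \<le>o |UNIV :: 'b set|"
    and sep: "separable_space mtopology" and "M \<noteq> {}"
  obtains B :: "'b set" and D f where
    "Metric_space B D" "Metric_space.mcomplete B D" "separable_space (Metric_space.mtopology B D)"
    "\<And>x. x \<in> M \<Longrightarrow> f x \<in> B" "\<And>x y. x \<in> M \<Longrightarrow> y \<in> M \<Longrightarrow> D (f x) (f y) = d x y"
    "\<And>y \<epsilon>. y \<in> B \<Longrightarrow> \<epsilon> > 0 \<Longrightarrow> \<exists>x\<in>M. D y (f x) < \<epsilon>"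
proof -
  obtain f0 :: "'a \<Rightarrow> 'a \<Rightarrow> real" and m' where m': "mcomplete_of m'" "f0 \<in> M \<rightarrow> mspace m'"
    "mtopology_of m' closure_of f0 ` M = mspace m'"
    "\<And>x y. x \<in> M \<Longrightarrow> y \<in> M \<Longrightarrow> mdist m' (f0 x) (f0 y) = d x y"
    using metric_completion by metis
  define N where "N = mspace m'"
  define dN where "dN = mdist m'"
  interpret N: Metric_space N dN
    by (simp add: N_def dN_def)
  have m'_eq: "m' = metric (N, dN)"
    by (simp add: N_def dN_def metric_collapse)
  have complete: "N.mcomplete"
    using m'(1) by (simp add: m'_eq)
  have f0: "f0 x \<in> N" if "x \<in> M" for x
    using m'(2) that by (auto simp: N_def)
  have iso: "dN (f0 x) (f0 y) = d x y" if "x \<in> M" "y \<in> M" for x y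
    using m'(4) that by (simp add: dN_def)
  have "N.mtopology closure_of f0 ` M = N"
    using m'(3) by (simp add: m'_eq)
  then have dense: "\<exists>x\<in>M. dN y (f0 x) < \<epsilon>" if "y \<in> N" "\<epsilon> > 0" for y \<epsilon>
    using that unfolding N.metric_closure_of by auto
  obtain s :: "nat \<Rightarrow> 'a" where s: "\<And>i. s i \<in> M" "\<And>x \<epsilon>. x \<in> M \<Longrightarrow> \<epsilon> > 0 \<Longrightarrow> \<exists>i. d x (s i) < \<epsilon>"
    using separable_dense_sequence[OF sep \<open>M \<noteq> {}\<close>] by blast
  have sdense: "\<exists>i. dN y (f0 (s i)) < \<epsilon>" if y: "y \<in> N" "\<epsilon> > 0" for y \<epsilon>
  proof -
    obtain x where x: "x \<in> M" "dN y (f0 x) < \<epsilon> / 2" using dense[of y "\<epsilon> / 2"] y by auto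
    obtain i where i: "d x (s i) < \<epsilon> / 2" using s(2)[of x "\<epsilon> / 2"] x y by auto
    have "dN y (f0 (s i)) \<le> dN y (f0 x) + dN (f0 x) (f0 (s i))"
      using y x s f0 by (intro N.triangle) auto
    with x i iso[of x "s i"] s have "dN y (f0 (s i)) < \<epsilon>" by simp
    then show ?thesis ..
  qed
  have "separable_space N.mtopology"
    by (rule N.separable_spaceI[of "f0 \<circ> s"]) (simp_all add: s f0 sdense)
  from ordLeq_transitive[OF N.separable_card_le_continuum[OF this] big]
  obtain g :: "('a \<Rightarrow> real) \<Rightarrow> 'b" where g: "inj_on g N"
    unfolding card_of_ordLeq[symmetric] by blast
  define h where "h = inv_into N g"
  have hg: "h (g x) = x" if "x \<in> N" for x
    using that g by (simp add: h_def)
  define B where "B = g ` N"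
  have hB: "h b \<in> N" "g (h b) = b" if "b \<in> B" for b
    using that by (auto simp: B_def h_def inv_into_into f_inv_into_f)
  define D where "D u v = dN (h u) (h v)" for u v
  interpret B: Metric_space B D
  proof
    show "0 \<le> D x y" "D x y = D y x" for x y
      by (simp_all add: D_def N.commute)
    show "D x y = 0 \<longleftrightarrow> x = y" if "x \<in> B" "y \<in> B" for x y
      using hB[OF that(1)] hB[OF that(2)] by (metis D_def N.zero)
    show "D x z \<le> D x y + D y z" if "x \<in> B" "y \<in> B" "z \<in> B" for x y z
      using that hB by (simp add: D_def N.triangle)
  qed
  define f where "f x = g (f0 x)" for x
  have fB: "f x \<in> B" if "x \<in> M" for x
    using that f0 by (simp add: f_def B_def)
  have Df: "D y (f x) = dN (h y) (f0 x)" if "x \<in> M" for x y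
    using that f0 by (simp add: f_def D_def hg)
  show thesis
  proof
    show "Metric_space B D" ..
    show "f x \<in> B" if "x \<in> M" for x
      using that by (rule fB)
    show "D (f x) (f y) = d x y" if "x \<in> M" "y \<in> M" for x y
      using that f0 by (simp add: f_def D_def hg iso)
    show "\<exists>x\<in>M. D y (f x) < \<epsilon>" if "y \<in> B" "\<epsilon> > 0" for y \<epsilon>
      using dense[OF hB(1)[OF that(1)] that(2)] Df by metis
    show "separable_space B.mtopology"
    proof (rule B.separable_spaceI)
      show "f (s i) \<in> B" for i using s(1) by (rule fB)
      show "\<exists>i. D y (f (s i)) < \<epsilon>" if "y \<in> B" "\<epsilon> > 0" for y \<epsilon>
        using sdense[OF hB(1)[OF that(1)] that(2)] by (simp add: Df s(1))
    qed
    show "B.mcomplete"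
      unfolding B.mcomplete_def
    proof (intro allI impI)
      fix \<sigma> assume \<sigma>: "B.MCauchy \<sigma>"
      then have \<sigma>B: "\<sigma> n \<in> B" for n by (auto simp: B.MCauchy_def)
      have "N.MCauchy (h \<circ> \<sigma>)"
        using \<sigma> hB(1)[OF \<sigma>B] by (simp add: B.MCauchy_def N.MCauchy_def D_def image_subset_iff)
      then obtain x where x: "limitin N.mtopology (h \<circ> \<sigma>) x sequentially"
        using complete by (auto simp: N.mcomplete_def)
      then have "x \<in> N" by (simp add: N.limitin_metric)
      then have "h (g x) = x" "g x \<in> B" by (simp_all add: hg B_def)
      with x \<sigma>B hB(1)[OF \<sigma>B] have "limitin B.mtopology \<sigma> (g x) sequentially"
        unfolding N.limit_metric_sequentially B.limit_metric_sequentially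
        by (simp add: D_def)
      then show "\<exists>x. limitin B.mtopology \<sigma> x sequentially" ..
    qed
  qed
qed

section \<open>Semigroups with a subinvariant metric\<close>

locale subinvariant_semigroup = carrier_semigroup S m + Metric_space S d
  for S :: "'a set" and m d +
  assumes subinvariant: "subinvariant S m d"
begin

lemma left_subinvariant:
  assumes "a \<in> S" "x \<in> S" "y \<in> S"
  shows "d (m a x) (m a y) \<le> d x y"
proof -
  have "d (sandwich m (Some a) x None) (sandwich m (Some a) y None) \<le> d x y"
    using assms subinvariant unfolding subinvariant_def by (auto simp: carrier1_def)
  then show ?thesis by (simp add: sandwich_def)
qed

lemma right_subinvariant:
  assumes "a \<in> S" "x \<in> S" "y \<in> S"
  shows "d (m x a) (m y a) \<le> d x y"
proof -
  have "d (sandwich m None x (Some a)) (sandwich m None y (Some a)) \<le> d x y"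
    using assms subinvariant unfolding subinvariant_def by (auto simp: carrier1_def)
  then show ?thesis by (simp add: sandwich_def)
qed

lemma dist_mult_le:
  assumes "x \<in> S" "y \<in> S" "x' \<in> S" "y' \<in> S"
  shows "d (m x y) (m x' y') \<le> d x x' + d y y'"
proof -
  have "d (m x y) (m x' y') \<le> d (m x y) (m x' y) + d (m x' y) (m x' y')"
    using assms by (intro triangle) auto
  then show ?thesis
    using left_subinvariant[of x' y y'] right_subinvariant[of y x x'] assms by linarith
qed

text \<open>Multiplication satisfies \<open>d (x y) (x' y') \<le> d x x' + d y y'\<close> and so extends to the completion by limits.
The product \<open>w\<close> of \<open>y\<^sub>1\<close> and \<open>y\<^sub>2\<close> is characterized by having distance at most
\<open>D (f x\<^sub>1) y\<^sub>1 + D (f x\<^sub>2) y\<^sub>2\<close> from \<open>f (x\<^sub>1 x\<^sub>2)\<close> for all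
\<open>x\<^sub>1, x\<^sub>2\<close>, which yields the semigroup laws without computing with sequences again.\<close>

lemma extend_mult_to_completion:
  fixes B :: "'b set" and f :: "'a \<Rightarrow> 'b"
  assumes "Metric_space B D" and complete: "Metric_space.mcomplete B D"
    and f: "\<And>x. x \<in> S \<Longrightarrow> f x \<in> B" and iso: "\<And>x y. x \<in> S \<Longrightarrow> y \<in> S \<Longrightarrow> D (f x) (f y) = d x y"
    and dense: "\<And>y \<epsilon>. y \<in> B \<Longrightarrow> \<epsilon> > 0 \<Longrightarrow> \<exists>x\<in>S. D y (f x) < \<epsilon>"
  obtains mul where "topological_semigroup (mul, Metric_space.mtopology B D)"
    "\<And>x y. x \<in> S \<Longrightarrow> y \<in> S \<Longrightarrow> f (m x y) = mul (f x) (f y)"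
proof -
  interpret B: Metric_space B D by fact
  define lim where "lim y1 y2 w \<longleftrightarrow> w \<in> B \<and>
    (\<forall>x1\<in>S. \<forall>x2\<in>S. D (f (m x1 x2)) w \<le> D (f x1) y1 + D (f x2) y2)" for y1 y2 w
  have ex_lim: "\<exists>w. lim y1 y2 w" if y: "y1 \<in> B" "y2 \<in> B" for y1 y2
  proof -
    have "\<exists>x\<in>S. D y1 (f x) < (1/2) ^ n" "\<exists>x\<in>S. D y2 (f x) < (1/2) ^ n" for n
      using y by (simp_all add: dense)
    then obtain a b where ab: "\<And>n. a n \<in> S" "\<And>n. D y1 (f (a n)) < (1/2) ^ n"
      "\<And>n. b n \<in> S" "\<And>n. D y2 (f (b n)) < (1/2) ^ n"
      by metis
    define c where "c n = f (m (a n) (b n))" for n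
    have cB: "c n \<in> B" for n by (simp add: c_def f ab)
    have c_dist: "D (f (m x1 x2)) (c n) \<le> D (f x1) (f (a n)) + D (f x2) (f (b n))"
      if "x1 \<in> S" "x2 \<in> S" for x1 x2 n
      using that ab dist_mult_le by (simp add: c_def iso)
    have near: "D (f x) (f (a n)) < D (f x) y1 + (1/2) ^ n" "D (f x) (f (b n)) < D (f x) y2 + (1/2) ^ n"
      if "x \<in> S" for x n
      using B.triangle[of "f x" y1 "f (a n)"] B.triangle[of "f x" y2 "f (b n)"] ab(2,4)[of n]
        that y f ab(1,3) by auto
    have "B.MCauchy c"
      unfolding B.MCauchy_def
    proof (intro conjI allI impI)
      show "range c \<subseteq> B" using cB by auto
      fix \<epsilon> :: real
      assume "\<epsilon> > 0"
      then obtain N where N: "(1/2) ^ N < \<epsilon> / 4"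
        using real_arch_pow_inv[of "\<epsilon> / 4" "1/2"] by auto
      have "D (c k) (c n) < \<epsilon>" if "N \<le> k" "N \<le> n" for k n
      proof -
        have le: "(1/2) ^ k \<le> (1/2 :: real) ^ N" "(1/2) ^ n \<le> (1/2 :: real) ^ N"
          using that by (auto intro: power_decreasing)
        have "D (c k) (c n) \<le> D (f (a k)) (f (a n)) + D (f (b k)) (f (b n))"
          unfolding c_def[of k] by (rule c_dist) (simp_all add: ab)
        also have "\<dots> < (D (f (a k)) y1 + (1/2) ^ n) + (D (f (b k)) y2 + (1/2) ^ n)"
          by (intro add_strict_mono near ab)
        finally have "D (c k) (c n) < (D (f (a k)) y1 + (1/2) ^ n) + (D (f (b k)) y2 + (1/2) ^ n)" .
        then show ?thesis
          using ab(2,4)[of k] le N B.commute[of y1 "f (a k)"] B.commute[of y2 "f (b k)"] by linarith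
      qed
      then show "\<exists>N. \<forall>n n'. N \<le> n \<longrightarrow> N \<le> n' \<longrightarrow> D (c n) (c n') < \<epsilon>" by blast
    qed
    then obtain w where w: "limitin B.mtopology c w sequentially"
      using complete by (auto simp: B.mcomplete_def)
    then have wB: "w \<in> B" by (simp add: B.limitin_metric)
    have "D (f (m x1 x2)) w \<le> D (f x1) y1 + D (f x2) y2" if x: "x1 \<in> S" "x2 \<in> S" for x1 x2
    proof (rule field_le_epsilon)
      fix \<epsilon> :: real
      assume "\<epsilon> > 0"
      then obtain N1 where N1: "\<And>n. n \<ge> N1 \<Longrightarrow> D (c n) w < \<epsilon> / 3"
        using w unfolding B.limit_metric_sequentially by (meson divide_pos_pos zero_less_numeral)
      obtain N2 where N2: "(1/2) ^ N2 < \<epsilon> / 3"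
        using real_arch_pow_inv[of "\<epsilon> / 3" "1/2"] \<open>\<epsilon> > 0\<close> by auto
      define n where "n = max N1 N2"
      have "(1/2) ^ n \<le> (1/2 :: real) ^ N2"
        by (rule power_decreasing) (auto simp: n_def)
      moreover have "D (f (m x1 x2)) w \<le> D (f (m x1 x2)) (c n) + D (c n) w"
        using x f cB wB by (intro B.triangle) auto
      moreover have "D (c n) w < \<epsilon> / 3"
        by (rule N1) (simp add: n_def)
      ultimately show "D (f (m x1 x2)) w \<le> D (f x1) y1 + D (f x2) y2 + \<epsilon>"
        using c_dist[OF x, of n] near(1)[OF x(1), of n] near(2)[OF x(2), of n] N2
        by linarith
    qed
    with wB show ?thesis by (auto simp: lim_def)
  qed
  define mul where "mul y1 y2 = (SOME w. lim y1 y2 w)" for y1 y2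
  have "lim y1 y2 (mul y1 y2)" if "y1 \<in> B" "y2 \<in> B" for y1 y2
    unfolding mul_def by (rule someI_ex) (rule ex_lim[OF that])
  then have mulB: "mul y1 y2 \<in> B"
    and mul_dist: "\<And>x1 x2. x1 \<in> S \<Longrightarrow> x2 \<in> S \<Longrightarrow>
      D (f (m x1 x2)) (mul y1 y2) \<le> D (f x1) y1 + D (f x2) y2"
    if "y1 \<in> B" "y2 \<in> B" for y1 y2
    using that by (simp_all add: lim_def)
  have hom: "f (m x1 x2) = mul (f x1) (f x2)" if "x1 \<in> S" "x2 \<in> S" for x1 x2
  proof -
    have "D (f (m x1 x2)) (mul (f x1) (f x2)) \<le> 0"
      using mul_dist[of "f x1" "f x2" x1 x2] that f by simp
    then show ?thesis
      using that f mulB by (metis B.nonneg B.zero m_closed order_antisym)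
  qed
  have lip: "D (mul y1 y2) (mul z1 z2) \<le> D y1 z1 + D y2 z2"
    if y: "y1 \<in> B" "y2 \<in> B" and z: "z1 \<in> B" "z2 \<in> B" for y1 y2 z1 z2
  proof (rule field_le_epsilon)
    fix \<epsilon> :: real
    assume "\<epsilon> > 0"
    then obtain x1 x2 where x: "x1 \<in> S" "D y1 (f x1) < \<epsilon> / 4" "x2 \<in> S" "D y2 (f x2) < \<epsilon> / 4"
      using dense[OF y(1), of "\<epsilon> / 4"] dense[OF y(2), of "\<epsilon> / 4"] by auto
    have "D (mul y1 y2) (mul z1 z2) \<le> D (f (m x1 x2)) (mul y1 y2) + D (f (m x1 x2)) (mul z1 z2)"
      using x y z mulB f by (intro B.triangle'') auto
    moreover have "D (f x1) z1 \<le> D y1 (f x1) + D y1 z1" "D (f x2) z2 \<le> D y2 (f x2) + D y2 z2"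
      using x y z f by (auto intro: B.triangle'')
    ultimately show "D (mul y1 y2) (mul z1 z2) \<le> D y1 z1 + D y2 z2 + \<epsilon>"
      using mul_dist[OF y x(1,3)] mul_dist[OF z x(1,3)] x(2,4) B.commute[of y1 "f x1"] B.commute[of y2 "f x2"]
      by linarith
  qed
  have assoc: "mul (mul y1 y2) y3 = mul y1 (mul y2 y3)" if y: "y1 \<in> B" "y2 \<in> B" "y3 \<in> B" for y1 y2 y3
  proof -
    have "D (mul (mul y1 y2) y3) (mul y1 (mul y2 y3)) \<le> 0"
    proof (rule field_le_epsilon)
      fix \<epsilon> :: real
      assume "\<epsilon> > 0"
      then obtain x1 x2 x3 where x: "x1 \<in> S" "D y1 (f x1) < \<epsilon> / 6" "x2 \<in> S" "D y2 (f x2) < \<epsilon> / 6"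
        "x3 \<in> S" "D y3 (f x3) < \<epsilon> / 6"
        using dense[OF y(1), of "\<epsilon> / 6"] dense[OF y(2), of "\<epsilon> / 6"] dense[OF y(3), of "\<epsilon> / 6"] by auto
      define p where "p = f (m x1 (m x2 x3))"
      have p: "p = mul (mul (f x1) (f x2)) (f x3)" "p = mul (f x1) (mul (f x2) (f x3))"
        using x hom[of "m x1 x2" x3] hom[of x1 x2] hom[of x1 "m x2 x3"] hom[of x2 x3]
        by (simp_all add: p_def m_assoc)
      have fx: "f x1 \<in> B" "f x2 \<in> B" "f x3 \<in> B" using x f by auto
      have "D (mul (mul y1 y2) y3) p \<le> D (mul y1 y2) (mul (f x1) (f x2)) + D y3 (f x3)"
        unfolding p(1) using y fx mulB by (intro lip) auto
      moreover have "D (mul y1 y2) (mul (f x1) (f x2)) \<le> D y1 (f x1) + D y2 (f x2)"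
        using y fx by (intro lip) auto
      moreover have "D (mul y1 (mul y2 y3)) p \<le> D y1 (f x1) + D (mul y2 y3) (mul (f x2) (f x3))"
        unfolding p(2) using y fx mulB by (intro lip) auto
      moreover have "D (mul y2 y3) (mul (f x2) (f x3)) \<le> D y2 (f x2) + D y3 (f x3)"
        using y fx by (intro lip) auto
      moreover have "D (mul (mul y1 y2) y3) (mul y1 (mul y2 y3))
          \<le> D (mul (mul y1 y2) y3) p + D (mul y1 (mul y2 y3)) p"
        using y fx mulB by (intro B.triangle') (auto simp: p)
      ultimately show "D (mul (mul y1 y2) y3) (mul y1 (mul y2 y3)) \<le> 0 + \<epsilon>"
        using x by linarith
    qed
    then show ?thesis
      using y mulB by (metis B.nonneg B.zero order_antisym)
  qed
  have "continuous_map (prod_topology B.mtopology B.mtopology) B.mtopology (\<lambda>(x, y). mul x y)"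
    unfolding continuous_map
  proof (intro conjI allI impI)
    show "(\<lambda>(x, y). mul x y) ` topspace (prod_topology B.mtopology B.mtopology) \<subseteq> topspace B.mtopology"
      using mulB by auto
    fix A
    assume A: "openin B.mtopology A"
    let ?P = "{p \<in> topspace (prod_topology B.mtopology B.mtopology). (case p of (x, y) \<Rightarrow> mul x y) \<in> A}"
    show "openin (prod_topology B.mtopology B.mtopology) ?P"
      unfolding openin_prod_topology_alt
    proof (intro allI impI)
      fix y1 y2
      assume "(y1, y2) \<in> ?P"
      then have y: "y1 \<in> B" "y2 \<in> B" "mul y1 y2 \<in> A" by auto
      with A obtain \<rho> where \<rho>: "\<rho> > 0" "B.mball (mul y1 y2) \<rho> \<subseteq> A"
        unfolding B.openin_mtopology by blast
      have "B.mball y1 (\<rho> / 2) \<times> B.mball y2 (\<rho> / 2) \<subseteq> ?P"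
      proof clarify
        fix z1 z2
        assume z: "z1 \<in> B.mball y1 (\<rho> / 2)" "z2 \<in> B.mball y2 (\<rho> / 2)"
        then have "D (mul y1 y2) (mul z1 z2) < \<rho>"
          using lip[of y1 y2 z1 z2] by simp
        with z have "mul z1 z2 \<in> B.mball (mul y1 y2) \<rho>"
          using mulB by simp
        with \<rho> z show "(z1, z2) \<in> topspace (prod_topology B.mtopology B.mtopology) \<and> mul z1 z2 \<in> A"
          by auto
      qed
      moreover have "y1 \<in> B.mball y1 (\<rho> / 2)" "y2 \<in> B.mball y2 (\<rho> / 2)"
        using y \<rho> by auto
      ultimately show "\<exists>U V. openin B.mtopology U \<and> openin B.mtopology V \<and> y1 \<in> U \<and> y2 \<in> V \<and> U \<times> V \<subseteq> ?P"
        using B.openin_mball by blast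
    qed
  qed
  then have "topological_semigroup (mul, B.mtopology)"
    by (simp add: topological_semigroup_def semigroup_on_def mulB assoc)
  then show thesis using hom by (rule that)
qed

text \<open>The semigroup is closed and dense in its completion, which is a Polish semigroup.\<close>

lemma injectively_closed_imp_mcomplete:
  fixes \<C> :: "'b topsemi set"
  assumes big: "|UNIV :: real set| \<le>o |UNIV :: 'b set|"
    and polish: "\<forall>Y :: 'b topsemi. polish_semigroup Y \<longrightarrow> Y \<in> \<C>"
    and closed: "injectively_closed \<C> S m" and sep: "separable_space mtopology" and "S \<noteq> {}"
  shows mcomplete
proof -
  obtain B :: "'b set" and D f where B: "Metric_space B D" and complete: "Metric_space.mcomplete B D"
    and sepB: "separable_space (Metric_space.mtopology B D)"
    and f: "\<And>x. x \<in> S \<Longrightarrow> f x \<in> B" and iso: "\<And>x y. x \<in> S \<Longrightarrow> y \<in> S \<Longrightarrow> D (f x) (f y) = d x y"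
    and dense: "\<And>y \<epsilon>. y \<in> B \<Longrightarrow> \<epsilon> > 0 \<Longrightarrow> \<exists>x\<in>S. D y (f x) < \<epsilon>"
    using separable_completion[OF big sep \<open>S \<noteq> {}\<close>] by blast
  interpret B: Metric_space B D by (rule B)
  obtain mul where mul: "topological_semigroup (mul, B.mtopology)"
    and hom: "\<And>x y. x \<in> S \<Longrightarrow> y \<in> S \<Longrightarrow> f (m x y) = mul (f x) (f y)"
    using extend_mult_to_completion[OF B complete f iso dense] by blast
  have "polish_semigroup (mul, B.mtopology)"
    using mul sepB B.completely_metrizable_space_mtopology[OF complete]
    by (simp add: polish_semigroup_def polish_topology_def)
  then have "(mul, B.mtopology) \<in> \<C>" using polish by blast
  moreover have "inj_on f S"
    using iso by (metis inj_onI mdist_zero zero f B.mdist_zero)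
  moreover have "f \<in> S \<rightarrow> topspace B.mtopology" using f by auto
  ultimately have "closedin B.mtopology (f ` S)"
    using closed[unfolded injectively_closed_def, rule_format, of "(mul, B.mtopology)" f] hom by simp
  then have "B.mtopology closure_of (f ` S) = f ` S"
    by (simp add: closure_of_closedin)
  moreover have "B.mtopology closure_of (f ` S) = B"
    unfolding B.metric_closure_of using dense f by auto
  ultimately have fS: "f ` S = B" by simp
  show mcomplete
    unfolding mcomplete_def
  proof (intro allI impI)
    fix \<sigma> assume \<sigma>: "MCauchy \<sigma>"
    then have \<sigma>S: "\<sigma> n \<in> S" for n by (auto simp: MCauchy_def)
    have "B.MCauchy (f \<circ> \<sigma>)"
      using \<sigma> \<sigma>S f unfolding MCauchy_def B.MCauchy_def by (auto simp: iso)
    then obtain y where y: "limitin B.mtopology (f \<circ> \<sigma>) y sequentially"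
      using complete by (auto simp: B.mcomplete_def)
    then have "y \<in> B" by (simp add: B.limitin_metric)
    then obtain x where x: "x \<in> S" "y = f x" using fS by blast
    have "limitin mtopology \<sigma> x sequentially"
      using y x \<sigma>S unfolding limit_metric_sequentially B.limit_metric_sequentially
      by (simp add: iso) meson
    then show "\<exists>x. limitin mtopology \<sigma> x sequentially" ..
  qed
qed

end

section \<open>Covers by few algebraic sets\<close>

lemma less_than_continuum_words:
  assumes "less_than_continuum C"
  shows "less_than_continuum (words C)"
proof -
  have "less_than_continuum (insert None (Some ` C))"
    using less_than_continuum_Un[of "{None}" "Some ` C"] less_than_continuum_image[OF assms, of Some]
      countable_less_than_continuum[of "{None}"] by simp
  from less_than_continuum_lists[OF this] show ?thesis
    by (rule less_than_continuum_subset) (auto simp: words_def)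
qed

context carrier_semigroup
begin

text \<open>Suppose that fewer than continuum many algebraic sets never cover \<open>S\<close>. Well-order \<open>S\<close> so that proper
initial segments have fewer elements than \<open>S\<close> and choose points \<open>z a\<close> by recursion, so that no word with
coefficients among the \<open>b\<close> and \<open>z b\<close> with \<open>b < a\<close> takes one of these \<open>b\<close> as its value at \<open>z a\<close>. Let
\<open>U c\<close> consist of the values at \<open>z a\<close> of such words, for \<open>a > c\<close>. These sets are closed under products,
because the smaller of two indices only contributes coefficients, and are absorbed by \<open>x \<le> c\<close>; but \<open>x\<close> is
not in \<open>U x\<close>, against zero-closedness.\<close>

lemma zero_closed_covered_by_small_family:
  assumes zc: "zero_closed S m" and inf: "infinite S" and small: "|S| \<le>o |UNIV :: real set|"
  shows "\<exists>Q\<subseteq>words S \<times> S. less_than_continuum Q \<and>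
    (\<forall>x\<in>S. \<exists>(l, b)\<in>Q. prodl m (subst_word l x) = b)"
proof (rule ccontr)
  assume no: "\<not> ?thesis"
  have escape: "\<exists>z\<in>S. \<forall>(l, b)\<in>Q. prodl m (subst_word l z) \<noteq> b"
    if "Q \<subseteq> words S \<times> S" "less_than_continuum Q" for Q
    using no that by blast
  define r where "r = |S|"
  have F: "Field r = S" and card: "Card_order r"
    by (simp_all add: r_def Field_card_of card_of_card_order_on)
  have wo: "well_order_on S r"
    by (simp add: r_def card_of_well_order_on)
  then have wf: "wf (r - Id)" and tr: "trans r" and as: "antisym r" and tot: "total_on S r"
    by (simp_all add: well_order_on_def linear_order_on_def partial_order_on_def preorder_on_def)
  define L where "L f a = underS r a \<union> f ` underS r a" for f :: "'a \<Rightarrow> 'a" and a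
  have under: "underS r a \<subseteq> S" for a
    using F by (auto simp: underS_def Field_def)
  define P where "P f a w \<longleftrightarrow> (a \<in> S \<longrightarrow> w \<in> S \<and>
    (\<forall>l\<in>words (L f a). \<forall>b\<in>underS r a. prodl m (subst_word l w) \<noteq> b))" for f a w
  have "\<exists>z. \<forall>a. P z a (z a)"
  proof (rule dependent_wf_choice[OF wf])
    fix f g :: "'a \<Rightarrow> 'a" and a w
    assume "\<And>b. (b, a) \<in> r - Id \<Longrightarrow> f b = g b"
    then have "L f a = L g a" by (auto simp: L_def underS_def image_iff)
    then show "P f a w = P g a w" by (simp add: P_def)
  next
    fix a and f :: "'a \<Rightarrow> 'a"
    assume IH: "\<And>b. (b, a) \<in> r - Id \<Longrightarrow> P f b (f b)"
    show "\<exists>w. P f a w"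
    proof (cases "a \<in> S")
      case True
      have fb: "f b \<in> S" if "b \<in> underS r a" for b
        using IH[of b] that under by (auto simp: P_def underS_def Field_def subset_iff)
      then have LS: "L f a \<subseteq> S" using under by (auto simp: L_def)
      have small_under: "less_than_continuum (underS r a)"
        using card_of_underS[OF card, of a] True F small by (auto simp: r_def intro: ordLess_ordLeq_trans)
      then have "less_than_continuum (L f a)"
        unfolding L_def by (intro less_than_continuum_Un less_than_continuum_image)
      then have "less_than_continuum (words (L f a) \<times> underS r a)"
        using small_under by (intro less_than_continuum_Times less_than_continuum_words)
      moreover have "words (L f a) \<times> underS r a \<subseteq> words S \<times> S"
        using words_mono[OF LS] under by blast
      ultimately obtain w where "w \<in> S"
        "\<forall>(l, b)\<in>words (L f a) \<times> underS r a. prodl m (subst_word l w) \<noteq> b"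
        using escape by blast
      then show ?thesis unfolding P_def by blast
    qed (auto simp: P_def)
  qed
  then obtain z where z: "\<And>a. P z a (z a)" by blast
  have zS: "z a \<in> S" if "a \<in> S" for a
    using z[of a] that by (simp add: P_def)
  have z_avoid: "prodl m (subst_word l (z a)) \<noteq> b" if "a \<in> S" "l \<in> words (L z a)" "b \<in> underS r a" for a l b
    using z[of a] that by (simp add: P_def)
  have LS: "L z a \<subseteq> S" for a
    using under[of a] zS by (auto simp: L_def)
  have under_trans: "a \<in> underS r c" if "a \<in> underS r b" "b \<in> underS r c" for a b c
    using that tr as by (auto simp: underS_def dest: transD antisymD)
  have under_total: "a = b \<or> a \<in> underS r b \<or> b \<in> underS r a" if "a \<in> S" "b \<in> S" for a b
    using that tot by (auto simp: underS_def total_on_def)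
  have L_mono: "insert (z a) (L z a) \<subseteq> L z b" if "a \<in> underS r b" for a b
    using that under_trans by (auto simp: L_def)
  define G where "G a = {prodl m xs | xs. set xs \<subseteq> insert (z a) (L z a) \<and> z a \<in> set xs}" for a
  \<comment> \<open>Only the largest index \<open>a\<close> has to exceed \<open>c\<close>; the other factors may come from anywhere below \<open>a\<close>.\<close>
  define U where "U c = (\<Union>a\<in>{a \<in> S. c \<in> underS r a}. G a)" for c
  have GI: "prodl m xs \<in> G a" if "set xs \<subseteq> insert (z a) (L z a)" "z a \<in> set xs" for xs a
    using that unfolding G_def by blast
  have UI: "y \<in> U c" if "y \<in> G a" "a \<in> S" "c \<in> underS r a" for y a c
    using that unfolding U_def by blast
  have UE: "\<exists>a xs. a \<in> S \<and> c \<in> underS r a \<and> y = prodl m xs \<and> xs \<noteq> [] \<and>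
      set xs \<subseteq> insert (z a) (L z a) \<and> z a \<in> set xs \<and> set xs \<subseteq> S" if y: "y \<in> U c" for y c
  proof -
    from y obtain a xs where a: "a \<in> S" "c \<in> underS r a" "y = prodl m xs"
      "set xs \<subseteq> insert (z a) (L z a)" "z a \<in> set xs"
      unfolding U_def G_def by blast
    moreover have "set xs \<subseteq> S" using a(4) LS[of a] zS[OF a(1)] by blast
    moreover have "xs \<noteq> []" using a(5) by auto
    ultimately show ?thesis by blast
  qed
  have US: "U c \<subseteq> S" for c
    using UE prodl_closed by (metis subsetI)
  have U_anti: "U c' \<subseteq> U c" if "c \<in> underS r c'" for c c'
    unfolding U_def using that under_trans by blast
  have U_max: "\<exists>c\<in>S. U c \<subseteq> U a \<inter> U b \<and> (c = a \<or> a \<in> underS r c) \<and> (c = b \<or> b \<in> underS r c)"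
    if "a \<in> S" "b \<in> S" for a b
    using under_total[OF that] U_anti that by blast
  have U_mult: "m y w \<in> U c" if yw: "y \<in> U c" "w \<in> U c" for y w c
  proof -
    obtain a xs where a: "a \<in> S" "c \<in> underS r a" "y = prodl m xs" "xs \<noteq> []"
      "set xs \<subseteq> insert (z a) (L z a)" "z a \<in> set xs" "set xs \<subseteq> S"
      using UE[OF yw(1)] by blast
    obtain b ys where b: "b \<in> S" "c \<in> underS r b" "w = prodl m ys" "ys \<noteq> []"
      "set ys \<subseteq> insert (z b) (L z b)" "z b \<in> set ys" "set ys \<subseteq> S"
      using UE[OF yw(2)] by blast
    have prod: "m y w = prodl m (xs @ ys)"
      using a b by (simp add: prodl_append)
    from under_total[OF a(1) b(1)] consider "a = b" | "a \<in> underS r b" | "b \<in> underS r a" by blast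
    then show ?thesis
    proof cases
      case 1
      then have "set (xs @ ys) \<subseteq> insert (z a) (L z a)" "z a \<in> set (xs @ ys)"
        using a(5,6) b(5) by auto
      then show ?thesis
        unfolding prod by (intro UI[OF GI a(1,2)])
    next
      case 2
      have "set (xs @ ys) \<subseteq> insert (z b) (L z b)" "z b \<in> set (xs @ ys)"
        using subset_trans[OF a(5) L_mono[OF 2]] b(5,6) by auto
      then show ?thesis
        unfolding prod by (intro UI[OF GI b(1,2)])
    next
      case 3
      have "set (xs @ ys) \<subseteq> insert (z a) (L z a)" "z a \<in> set (xs @ ys)"
        using subset_trans[OF b(5) L_mono[OF 3]] a(5,6) by auto
      then show ?thesis
        unfolding prod by (intro UI[OF GI a(1,2)])
    qed
  qed
  have U_ideal: "m x y \<in> U c \<and> m y x \<in> U c" if y: "y \<in> U c" and x: "x = c \<or> x \<in> underS r c" and "x \<in> S" for x y c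
  proof -
    obtain a xs where a: "a \<in> S" "c \<in> underS r a" "y = prodl m xs" "xs \<noteq> []"
      "set xs \<subseteq> insert (z a) (L z a)" "z a \<in> set xs" "set xs \<subseteq> S"
      using UE[OF y] by blast
    have "x \<in> L z a" using x a(2) under_trans by (auto simp: L_def)
    moreover have "m x y = prodl m ([x] @ xs)" "m y x = prodl m (xs @ [x])"
      using a \<open>x \<in> S\<close> by (simp_all add: prodl_append del: append_Cons append_Nil)
    moreover have "prodl m ([x] @ xs) \<in> U c" "prodl m (xs @ [x]) \<in> U c"
      using a(5,6) \<open>x \<in> L z a\<close> by (intro UI[OF GI a(1,2)]; simp)+
    ultimately show ?thesis by simp
  qed
  obtain x where x: "x \<in> S" "\<And>V. V \<in> U ` S \<Longrightarrow> x \<in> V"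
  proof (rule zero_closedD[OF zc])
    show "U ` S \<noteq> {}" using inf by auto
    show "V \<subseteq> S" if "V \<in> U ` S" for V
      using US that by auto
    show "V \<noteq> {}" if V: "V \<in> U ` S" for V
    proof -
      obtain c where c: "c \<in> S" "V = U c" using V by blast
      obtain a where "a \<in> S" "c \<in> underS r a"
        using infinite_Card_order_limit[OF card, of c] inf c F by (auto simp: underS_def)
      then have "prodl m [z a] \<in> U c" by (intro UI[of _ a] GI) auto
      with c show ?thesis by blast
    qed
    show "\<exists>W\<in>U ` S. W \<subseteq> V \<inter> V'" if "V \<in> U ` S" "V' \<in> U ` S" for V V'
    proof -
      obtain a b where ab: "a \<in> S" "V = U a" "b \<in> S" "V' = U b"
        using \<open>V \<in> U ` S\<close> \<open>V' \<in> U ` S\<close> by auto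
      then show ?thesis using U_max[OF ab(1,3)] by auto
    qed
    show "\<exists>W\<in>U ` S. \<forall>y\<in>W. m x y \<in> V \<and> m y x \<in> V" if V: "V \<in> U ` S" and x: "x \<in> S" for V x
    proof -
      obtain a where a: "a \<in> S" "V = U a" using V by blast
      obtain c where c: "c \<in> S" "U c \<subseteq> U a" "x = c \<or> x \<in> underS r c"
        using U_max[OF a(1) x] by blast
      then have "\<forall>y\<in>U c. m x y \<in> V \<and> m y x \<in> V"
        using U_ideal[OF _ c(3) x] a by auto
      with c show ?thesis by auto
    qed
    show "\<exists>W\<in>U ` S. \<forall>y\<in>W. \<forall>w\<in>W. m y w \<in> V" if "V \<in> U ` S" for V
      using that U_mult by auto
  qed auto
  then have "x \<in> U x" by blast
  then obtain a xs where a: "a \<in> S" "x \<in> underS r a" "x = prodl m xs"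
    "set xs \<subseteq> insert (z a) (L z a)" "z a \<in> set xs"
    using UE by blast
  from a(4,5) obtain l where "l \<in> words (L z a)" "subst_word l (z a) = xs"
    by (rule word_of_list)
  with z_avoid[OF a(1) _ a(2)] a(3) show False by metis
qed

end

section \<open>Finitely many polynomials approximate a point of the minimal ideal\<close>

text \<open>Here \<open>y\<close> is a product of elements of \<open>S\<close> whose factors are approximated by the letters of the list
over \<open>T\<close>, and \<open>e\<close> is the sum of the tolerances granted to the factors. Each tolerance is at
least \<open>\<delta>\<close>, also for exact letters, so that \<open>e\<close> bounds the error and \<open>e / \<delta>\<close> the
length of the word.\<close>

inductive approx_prod :: "('a \<Rightarrow> 'a \<Rightarrow> 'a) \<Rightarrow> ('a \<Rightarrow> 'a \<Rightarrow> real) \<Rightarrow> 'a set \<Rightarrow> 'a set \<Rightarrow> real \<Rightarrow>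
    'a \<Rightarrow> 'a list \<Rightarrow> real \<Rightarrow> bool"
  for m d S T \<delta> where
  letter: "y \<in> S \<Longrightarrow> t \<in> T \<Longrightarrow> d y t \<le> e \<Longrightarrow> \<delta> \<le> e \<Longrightarrow> approx_prod m d S T \<delta> y [t] e"
| mult: "approx_prod m d S T \<delta> y l e \<Longrightarrow> approx_prod m d S T \<delta> y' l' e' \<Longrightarrow>
    approx_prod m d S T \<delta> (m y y') (l @ l') (e + e')"

lemma approx_prod_mono:
  assumes "approx_prod m d S T \<delta> y l e" "T \<subseteq> T'" "\<delta>' \<le> \<delta>"
  shows "approx_prod m d S T' \<delta>' y l e"
  using assms(1)
proof induction
  case (letter y t e)
  then show ?case using assms(2,3) by (intro approx_prod.letter) auto
qed (rule approx_prod.mult)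

context subinvariant_semigroup
begin

lemma approx_prod_props:
  assumes "approx_prod m d S T \<delta> y l e" "T \<subseteq> S"
  shows "y \<in> S \<and> l \<noteq> [] \<and> set l \<subseteq> T \<and> d y (prodl m l) \<le> e \<and> \<delta> * length l \<le> e"
  using assms(1)
proof induction
  case (letter y t e)
  then show ?case by simp
next
  case (mult y l e y' l' e')
  then have S: "set l \<subseteq> S" "set l' \<subseteq> S" using assms(2) by auto
  then have "d (m y y') (prodl m (l @ l')) \<le> d y (prodl m l) + d y' (prodl m l')"
    using mult by (simp add: prodl_append dist_mult_le prodl_closed)
  with mult show ?case
    by (simp add: distrib_left)
qed

text \<open>Suppose that each finite set of words has a point of \<open>S\<close> at which all its values have distance at
least \<open>\<epsilon>\<close> from \<open>x0\<close>. Let \<open>s\<close> be a dense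
sequence and choose \<open>z k\<close> recursively, so that all words of length at most \<open>2\<^sup>k\<close> in the letters \<open>s i\<close>,
\<open>i \<le> k\<close>, and \<open>z j\<close>, \<open>j < k\<close>, have at \<open>z k\<close> a value at distance at least \<open>\<epsilon>\<close> from \<open>x0\<close>. These are
finitely many conditions. Arbitrary elements of \<open>S\<close> have to be admitted as factors, too, and are approximated by letters:
\<open>U n\<close> consists of the products with total tolerance at most \<open>2\<^sup>-\<^sup>n\<close>, where the largest occurring \<open>z k\<close>
has \<open>k \<ge> n\<close> and each factor has tolerance at least \<open>2\<^sup>-\<^sup>k\<close>. Halving the tolerance makes
room for a product of two members, or for one new factor \<open>x\<close> with the fixed tolerance \<open>2\<^sup>-\<^sup>n\<^sup>-\<^sup>1\<close>. So the sets
\<open>U n\<close> have a common point \<open>x\<close>; as \<open>x0\<close> lies in the minimal ideal, \<open>x0 = u x v\<close> is another one, but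
the members of \<open>U n\<close> stay away from \<open>x0\<close> once \<open>2\<^sup>-\<^sup>n < \<epsilon>\<close>.\<close>

lemma zero_closed_finitely_many_words_near:
  assumes zc: "zero_closed S m" and sep: "separable_space mtopology"
    and x0: "x0 \<in> min_ideal S m" and "\<epsilon> > 0"
  shows "\<exists>Q\<subseteq>words S. finite Q \<and> (\<forall>x\<in>S. \<exists>l\<in>Q. d (prodl m (subst_word l x)) x0 < \<epsilon>)"
proof (rule ccontr)
  assume no: "\<not> ?thesis"
  have escape: "\<exists>z\<in>S. \<forall>l\<in>Q. \<epsilon> \<le> d (prodl m (subst_word l z)) x0" if "Q \<subseteq> words S" "finite Q" for Q
  proof (rule ccontr)
    assume "\<not> ?thesis"
    then have "\<forall>x\<in>S. \<exists>l\<in>Q. d (prodl m (subst_word l x)) x0 < \<epsilon>"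
      by (simp add: not_le)
    with that have "\<exists>Q\<subseteq>words S. finite Q \<and>
        (\<forall>x\<in>S. \<exists>l\<in>Q. d (prodl m (subst_word l x)) x0 < \<epsilon>)"
      by (intro exI[of _ Q] conjI)
    with no show False by contradiction
  qed
  have x0S: "x0 \<in> S" by (rule subsetD[OF min_ideal_subset x0])
  then have "S \<noteq> {}" by blast
  obtain s :: "nat \<Rightarrow> 'a" where s: "\<And>i. s i \<in> S"
    "\<And>x \<epsilon>. x \<in> S \<Longrightarrow> \<epsilon> > 0 \<Longrightarrow> \<exists>i. d x (s i) < \<epsilon>"
    using separable_dense_sequence[OF sep \<open>S \<noteq> {}\<close>] by blast
  define T' where "T' f k = s ` {..k} \<union> f ` {..<k}" for f :: "nat \<Rightarrow> 'a" and k
  define P where "P f k w \<longleftrightarrow> w \<in> S \<and>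
    (\<forall>l\<in>words (T' f k). length l \<le> 2 ^ k \<longrightarrow> \<epsilon> \<le> d (prodl m (subst_word l w)) x0)" for f k w
  have "\<exists>z. \<forall>k. P z k (z k)"
  proof (rule dependent_wellorder_choice)
    fix f g :: "nat \<Rightarrow> 'a" and k w
    assume "\<And>j. j < k \<Longrightarrow> f j = g j"
    then have "T' f k = T' g k" by (simp add: T'_def)
    then show "P f k w = P g k w" by (simp add: P_def)
  next
    fix k and f :: "nat \<Rightarrow> 'a"
    assume "\<And>j. j < k \<Longrightarrow> P f j (f j)"
    then have T'S: "T' f k \<subseteq> S" using s(1) by (auto simp: T'_def P_def)
    define Q where "Q = {l \<in> words (T' f k). length l \<le> 2 ^ k}"
    have "finite {l. set l \<subseteq> insert None (Some ` T' f k) \<and> length l \<le> 2 ^ k}"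
      by (rule finite_lists_length_le) (simp add: T'_def)
    then have "finite Q"
      by (rule finite_subset[rotated]) (auto simp: Q_def words_def)
    moreover have "Q \<subseteq> words S"
      using words_mono[OF T'S] by (auto simp: Q_def)
    ultimately obtain w where "w \<in> S" "\<forall>l\<in>Q. \<epsilon> \<le> d (prodl m (subst_word l w)) x0"
      using escape by blast
    then have "P f k w" by (simp add: P_def Q_def)
    then show "\<exists>w. P f k w" ..
  qed
  then obtain z where z: "\<And>k. P z k (z k)" by blast
  have zS: "z k \<in> S" for k using z[of k] by (simp add: P_def)
  define T where "T k = insert (z k) (T' z k)" for k
  have TS: "T k \<subseteq> S" for k using s(1) zS by (auto simp: T_def T'_def)
  have "{..k} = insert k {..<k}" for k :: nat by auto
  then have T_eq: "T k = s ` {..k} \<union> z ` {..k}" for k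
    by (simp add: T_def T'_def)
  have T_mono: "T j \<subseteq> T k" if "j \<le> k" for j k
    unfolding T_eq using that by (intro Un_mono image_mono) auto
  define A where "A k = approx_prod m d S (T k) ((1/2) ^ k)" for k
  have A_mono: "A k y l e" if "A j y l e" "j \<le> k" for j k y l e
    using approx_prod_mono[OF that(1)[unfolded A_def] T_mono[OF that(2)]] that(2)
    by (simp add: A_def power_decreasing)
  have A_mult: "A k (m y y') (l @ l') (e + e')" if "A k y l e" "A k y' l' e'" for k y l e y' l' e'
    using that unfolding A_def by (rule approx_prod.mult)
  have A_props: "y \<in> S" "d y (prodl m l) \<le> e" "(1/2) ^ k * length l \<le> e" "set l \<subseteq> T k" "l \<noteq> []"
    if "A k y l e" for k y l e
    using approx_prod_props[OF that[unfolded A_def] TS] by auto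
  define U where "U n = {y. \<exists>k\<ge>n. \<exists>l e. A k y l e \<and> z k \<in> set l \<and> e \<le> (1/2) ^ n}" for n :: nat
  have UI: "y \<in> U n" if "A k y l e" "n \<le> k" "z k \<in> set l" "e \<le> (1/2) ^ n" for y n k l e
    using that unfolding U_def by blast
  have UE: "\<exists>k l e. A k y l e \<and> n \<le> k \<and> z k \<in> set l \<and> e \<le> (1/2) ^ n" if "y \<in> U n" for y n
    using that unfolding U_def by blast
  have US: "U n \<subseteq> S" for n
    using UE A_props(1) by blast
  have U_anti: "U n \<subseteq> U j" if "j \<le> n" for j n
  proof
    fix y assume "y \<in> U n"
    then obtain k l e where k: "A k y l e" "n \<le> k" "z k \<in> set l" "e \<le> (1/2) ^ n"
      using UE by blast
    have "(1/2) ^ n \<le> (1/2 :: real) ^ j"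
      using that by (rule power_decreasing) auto
    with k(4) have "e \<le> (1/2) ^ j" by (rule order_trans)
    with k(1) le_trans[OF that k(2)] k(3) show "y \<in> U j" by (rule UI)
  qed
  have U_mult: "m y w \<in> U n" if yw: "y \<in> U (Suc n)" "w \<in> U (Suc n)" for y w n
  proof -
    obtain k l e where k: "A k y l e" "Suc n \<le> k" "z k \<in> set l" "e \<le> (1/2) ^ Suc n"
      using UE[OF yw(1)] by blast
    obtain k' l' e' where k': "A k' w l' e'" "Suc n \<le> k'" "z k' \<in> set l'" "e' \<le> (1/2) ^ Suc n"
      using UE[OF yw(2)] by blast
    have "A (max k k') (m y w) (l @ l') (e + e')"
      by (rule A_mult[OF A_mono[OF k(1) max.cobounded1] A_mono[OF k'(1) max.cobounded2]])
    moreover have "z (max k k') \<in> set (l @ l')"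
      using k(3) k'(3) by (auto simp: max_def)
    moreover have "e + e' \<le> (1/2) ^ n"
      using k(4) k'(4) by simp
    ultimately show ?thesis
      using k(2) by (intro UI[of "max k k'" "m y w" "l @ l'" "e + e'"]) simp_all
  qed
  have U_translate: "\<exists>j. \<forall>y\<in>U j. m x y \<in> U n \<and> m y x \<in> U n" if x: "x \<in> S" for x n
  proof -
    obtain i where i: "d x (s i) < (1/2) ^ Suc n"
      using s(2)[OF x, of "(1/2) ^ Suc n"] by auto
    have "m x y \<in> U n \<and> m y x \<in> U n" if y: "y \<in> U (max (Suc n) i)" for y
    proof -
      obtain k l e where k: "A k y l e" "max (Suc n) i \<le> k" "z k \<in> set l" "e \<le> (1/2) ^ max (Suc n) i"
        using UE[OF y] by blast
      have "(1/2) ^ max (Suc n) i \<le> (1/2 :: real) ^ Suc n"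
        by (rule power_decreasing) auto
      with k(4) have "e \<le> (1/2) ^ Suc n" by (rule order_trans)
      then have e: "e + (1/2) ^ Suc n \<le> (1/2) ^ n" by simp
      have "(1/2) ^ k \<le> (1/2 :: real) ^ Suc n"
        using k(2) by (intro power_decreasing) auto
      moreover have "s i \<in> T k" using k(2) by (auto simp: T_def T'_def)
      ultimately have "A k x [s i] ((1/2) ^ Suc n)"
        unfolding A_def using x i by (intro approx_prod.letter) auto
      from A_mult[OF this k(1)] A_mult[OF k(1) this] k(2,3) e show ?thesis
        by (auto intro!: UI[of k] simp: add.commute)
    qed
    then show ?thesis by blast
  qed
  obtain x where x: "x \<in> S" "\<And>V. V \<in> range U \<Longrightarrow> x \<in> V"
  proof (rule zero_closedD[OF zc])
    show "V \<subseteq> S" if "V \<in> range U" for V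
      using that US by auto
    show "V \<noteq> {}" if V: "V \<in> range U" for V
    proof -
      obtain n where n: "V = U n" using V by auto
      have "A n (z n) [z n] ((1/2) ^ n)"
        unfolding A_def using zS by (intro approx_prod.letter) (auto simp: T_def)
      then have "z n \<in> U n" by (rule UI) auto
      with n show ?thesis by auto
    qed
    show "\<exists>W\<in>range U. W \<subseteq> V \<inter> V'" if V: "V \<in> range U" "V' \<in> range U" for V V'
    proof -
      obtain i j where "V = U i" "V' = U j" using V by auto
      then have "U (max i j) \<subseteq> V \<inter> V'" using U_anti by simp
      then show ?thesis by auto
    qed
    show "\<exists>W\<in>range U. \<forall>y\<in>W. m x y \<in> V \<and> m y x \<in> V" if "V \<in> range U" "x \<in> S" for V x
      using U_translate[OF that(2)] that(1) by auto
    show "\<exists>W\<in>range U. \<forall>y\<in>W. \<forall>w\<in>W. m y w \<in> V" if V: "V \<in> range U" for V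
    proof -
      obtain n where n: "V = U n" using V by auto
      have "\<forall>y\<in>U (Suc n). \<forall>w\<in>U (Suc n). m y w \<in> U n"
        using U_mult by simp
      with n show ?thesis by auto
    qed
  qed auto
  obtain u v where uv: "u \<in> S" "v \<in> S" "x0 = m (m u x) v"
    using x0 x(1) by (auto simp: min_ideal_def)
  obtain N where N: "(1/2) ^ N < \<epsilon>"
    using real_arch_pow_inv[OF \<open>\<epsilon> > 0\<close>, of "1/2"] by auto
  obtain i where i: "\<forall>y\<in>U i. m v y \<in> U N \<and> m y v \<in> U N" using U_translate[OF uv(2)] by blast
  obtain j where j: "\<forall>y\<in>U j. m u y \<in> U i \<and> m y u \<in> U i" using U_translate[OF uv(1)] by blast
  have "x \<in> U j" using x(2) by blast
  with i j uv(3) have "x0 \<in> U N" by blast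
  then obtain k l e where k: "A k x0 l e" "N \<le> k" "z k \<in> set l" "e \<le> (1/2) ^ N"
    using UE by blast
  have "(1/2) ^ k * length l \<le> (1 :: real)"
    using A_props(3)[OF k(1)] k(4) power_le_one[of "1/2 :: real" N] by linarith
  then have "real (length l) \<le> 2 ^ k"
    by (simp add: power_one_over field_simps)
  then have len: "length l \<le> 2 ^ k"
    by (metis of_nat_le_iff of_nat_numeral of_nat_power)
  have "set l \<subseteq> insert (z k) (T' z k)"
    using A_props(4)[OF k(1)] by (simp add: T_def)
  from word_of_list[OF this k(3)] obtain w where w: "w \<in> words (T' z k)" "subst_word w (z k) = l"
    "length w = length l" by blast
  have "\<forall>w\<in>words (T' z k). length w \<le> 2 ^ k \<longrightarrow> \<epsilon> \<le> d (prodl m (subst_word w (z k))) x0"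
    using z[of k] by (simp add: P_def)
  from bspec[OF this w(1)] w(2,3) len have "\<epsilon> \<le> d (prodl m l) x0" by simp
  moreover have "d x0 (prodl m l) < \<epsilon>"
    using A_props(2)[OF k(1)] k(4) N by linarith
  ultimately show False by (simp add: commute)
qed

end

section \<open>Polyboundedness\<close>

context subinvariant_semigroup
begin

lemma word_value_lipschitz:
  assumes l: "l \<noteq> []" "set l \<subseteq> insert None (Some ` S)" and xy: "x \<in> S" "y \<in> S"
  shows "d (prodl m (subst_word l x)) (prodl m (subst_word l y)) \<le> length l * d x y"
  using l
proof (induction l rule: list_nonempty_induct)
  case (single q)
  then show ?case using xy by (cases q) auto
next
  case (cons q l)
  let ?q = "\<lambda>x. case q of None \<Rightarrow> x | Some c \<Rightarrow> c"
  have q: "?q x \<in> S" "?q y \<in> S" "d (?q x) (?q y) \<le> d x y"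
    using cons.prems xy by (auto split: option.splits)
  have sub: "set (subst_word l w) \<subseteq> S" if "w \<in> S" for w
    using cons.prems that by (auto simp: subst_word_def split: option.splits)
  have eq: "prodl m (subst_word (q # l) w) = m (?q w) (prodl m (subst_word l w))" for w
    using cons.hyps by (cases q) (simp_all add: prodl_Cons)
  have "d (prodl m (subst_word (q # l) x)) (prodl m (subst_word (q # l) y))
      \<le> d (?q x) (?q y) + d (prodl m (subst_word l x)) (prodl m (subst_word l y))"
    unfolding eq using q sub xy cons.hyps by (intro dist_mult_le prodl_closed) auto
  also have "\<dots> \<le> d x y + length l * d x y"
    using q(3) cons by (intro add_mono) auto
  finally show ?case by (simp add: distrib_right)
qed

lemma openin_word_neq:
  assumes l: "l \<in> words S" and b: "b \<in> S"
  shows "openin mtopology {x \<in> S. prodl m (subst_word l x) \<noteq> b}"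
  unfolding openin_mtopology
proof (intro conjI allI impI)
  fix x
  assume "x \<in> {x \<in> S. prodl m (subst_word l x) \<noteq> b}"
  then have x: "x \<in> S" "prodl m (subst_word l x) \<noteq> b" by auto
  define r where "r = d (prodl m (subst_word l x)) b / length l"
  have len: "real (length l) > 0" using words_ne[OF l] by simp
  have "r > 0"
    using x b l len by (simp add: r_def word_closed)
  moreover have "mball x r \<subseteq> {x \<in> S. prodl m (subst_word l x) \<noteq> b}"
  proof clarsimp
    fix y assume y: "y \<in> S" "d x y < r" "b = prodl m (subst_word l y)"
    have "d (prodl m (subst_word l x)) b \<le> length l * d x y"
      unfolding y(3) using l words_ne[OF l] x y(1) by (intro word_value_lipschitz) (auto simp: words_def)
    also have "\<dots> < length l * r"
      using y(2) len by simp
    also have "\<dots> = d (prodl m (subst_word l x)) b"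
      using len by (simp add: r_def)
    finally show False by simp
  qed
  ultimately show "\<exists>r>0. mball x r \<subseteq> {x \<in> S. prodl m (subst_word l x) \<noteq> b}" by blast
qed auto

text \<open>Otherwise the complements of algebraic sets are open and dense relative to the minimal ideal, so
fewer than continuum many algebraic sets do not cover \<open>S\<close>.\<close>

lemma word_constant_near_min_ideal:
  assumes zc: "zero_closed S m" and inf: "infinite S"
    and sep: "separable_space mtopology" and complete: mcomplete
    and cov: "cov_meager =o |UNIV :: real set|"
  shows "\<exists>x0\<in>min_ideal S m. \<exists>\<epsilon>>0. \<exists>p\<in>words S. \<exists>b\<in>S.
    \<forall>y\<in>min_ideal S m. d x0 y < \<epsilon> \<longrightarrow> prodl m (subst_word p y) = b"
proof (rule ccontr)
  assume "\<not> ?thesis"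
  then have no: "\<exists>y\<in>min_ideal S m. d x0 y < \<epsilon> \<and> prodl m (subst_word p y) \<noteq> b"
    if "x0 \<in> min_ideal S m" "\<epsilon> > 0" "p \<in> words S" "b \<in> S" for x0 \<epsilon> p b
    using that by auto
  obtain Q where Q: "Q \<subseteq> words S \<times> S" "less_than_continuum Q"
    "\<forall>x\<in>S. \<exists>(l, b)\<in>Q. prodl m (subst_word l x) = b"
    using zero_closed_covered_by_small_family[OF zc inf separable_card_le_continuum[OF sep]] by blast
  define G where "G = (\<lambda>(l, b). {x \<in> S. prodl m (subst_word l x) \<noteq> b})"
  have "S \<noteq> {}" using inf by auto
  have "\<exists>z\<in>S. \<forall>H\<in>G ` Q. z \<in> H"
  proof (rule generic_point[OF cov complete sep min_ideal_subset
        zero_closed_min_ideal_nonempty[OF zc \<open>S \<noteq> {}\<close>] less_than_continuum_image[OF Q(2)]])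
    fix H assume "H \<in> G ` Q"
    then obtain l b where H: "H = {x \<in> S. prodl m (subst_word l x) \<noteq> b}" "l \<in> words S" "b \<in> S"
      using Q(1) by (auto simp: G_def)
    then show "openin mtopology H"
      by (simp add: openin_word_neq)
    show "\<exists>y\<in>min_ideal S m \<inter> H. d x y < \<epsilon>" if "x \<in> min_ideal S m" "\<epsilon> > 0" for x \<epsilon>
      using no[OF that H(2,3)] min_ideal_subset[of S m] unfolding H(1) by blast
  qed
  then obtain z where z: "z \<in> S" "\<forall>H\<in>G ` Q. z \<in> H" by blast
  with Q(3) obtain l b where "(l, b) \<in> Q" "prodl m (subst_word l z) = b" by blast
  with z(2) show False by (auto simp: G_def)
qed

text \<open>Near the point \<open>x0\<close> of the minimal ideal \<open>K\<close> some word \<open>p\<close> is constant on \<open>K\<close>, and there is a finite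
set of words \<open>l\<close> one of which takes a value close to \<open>x0\<close> at any given \<open>x\<close>. Writing \<open>x0 = u x0 x0 x0 v\<close>, the words \<open>u x0 l x0 v\<close> do the same
and have their values in the ideal \<open>K\<close>, so their compositions with \<open>p\<close> define
finitely many algebraic sets that cover \<open>S\<close>.\<close>

lemma zero_closed_imp_polybounded:
  assumes zc: "zero_closed S m" and sep: "separable_space mtopology" and complete: mcomplete
    and cov: "cov_meager =o |UNIV :: real set|"
  shows "polybounded S m"
proof (cases "finite S")
  case True
  then show ?thesis by (rule finite_imp_polybounded)
next
  case False
  obtain x0 \<epsilon> p b where x0: "x0 \<in> min_ideal S m" and "\<epsilon> > 0" and p: "p \<in> words S" and b: "b \<in> S"
    and const: "\<forall>y\<in>min_ideal S m. d x0 y < \<epsilon> \<longrightarrow> prodl m (subst_word p y) = b"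
    using word_constant_near_min_ideal[OF zc False sep complete cov] by blast
  obtain Q where Q: "Q \<subseteq> words S" "finite Q"
    "\<forall>x\<in>S. \<exists>l\<in>Q. d (prodl m (subst_word l x)) x0 < \<epsilon>"
    using zero_closed_finitely_many_words_near[OF zc sep x0 \<open>\<epsilon> > 0\<close>] by auto
  have x0S: "x0 \<in> S" by (rule subsetD[OF min_ideal_subset x0])
  obtain u v where uv: "u \<in> S" "v \<in> S" "x0 = m (m u (m x0 (m x0 x0))) v"
    using x0 x0S unfolding min_ideal_def by blast
  define W where "W l = [Some u, Some x0] @ l @ [Some x0, Some v]" for l :: "'a option list"
  have W_words: "W l \<in> words S" if "l \<in> words S" for l
    using that uv(1,2) x0S by (auto simp: W_def words_def)
  have W_val: "prodl m (subst_word (W l) x) = m (m u x0) (m (prodl m (subst_word l x)) (m x0 v))"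
    if l: "l \<in> words S" and x: "x \<in> S" for l x
  proof -
    have sub: "set (subst_word l x) \<subseteq> S" "subst_word l x \<noteq> []"
      using subst_word_subset[OF l, of x] x words_ne[OF l] by auto
    have "subst_word (W l) x = [u, x0] @ (subst_word l x @ [x0, v])"
      by (simp add: W_def)
    also have "prodl m \<dots> = m (prodl m [u, x0]) (m (prodl m (subst_word l x)) (prodl m [x0, v]))"
      using sub uv(1,2) x0S by (simp add: prodl_append del: append_Cons append_Nil)
    finally show ?thesis by simp
  qed
  have pS: "set p \<subseteq> insert None (Some ` S)"
    using p by (simp add: words_def)
  define F where "F = (\<lambda>l. (compose_word p (W l), b)) ` Q"
  show ?thesis
  proof (rule polyboundedI[of F])
    show "finite F" using Q(2) by (simp add: F_def)
    show "l \<in> words S \<and> c \<in> S" if "(l, c) \<in> F" for l c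
      using that Q(1) b p by (auto simp: F_def intro!: compose_word_words W_words)
    fix x assume x: "x \<in> S"
    then obtain l where l: "l \<in> Q" "d (prodl m (subst_word l x)) x0 < \<epsilon>" using Q(3) by blast
    let ?y = "prodl m (subst_word l x)"
    let ?w = "m (m u x0) (m ?y (m x0 v))"
    have lS: "l \<in> words S" using l(1) Q(1) by blast
    have y: "?y \<in> S" using word_closed[OF lS x] .
    have "?w \<in> min_ideal S m"
      by (intro min_ideal_mult(1)[OF min_ideal_mult(1)[OF min_ideal_mult(2)[OF x0 uv(2)] y]])
        (use uv(1) x0S in simp)
    moreover have "d x0 ?w < \<epsilon>"
    proof -
      have "x0 = m (m u x0) (m x0 (m x0 v))"
        using uv(1,2) x0S by (subst uv(3)) (simp add: m_assoc)
      then have "d x0 ?w = d (m (m u x0) (m x0 (m x0 v))) ?w"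
        by (rule arg_cong[where f = "\<lambda>t. d t ?w"])
      also have "\<dots> \<le> d (m x0 (m x0 v)) (m ?y (m x0 v))"
        using uv(1,2) x0S y by (intro left_subinvariant) auto
      also have "\<dots> \<le> d x0 ?y"
        using uv(1,2) x0S y by (intro right_subinvariant) auto
      finally show ?thesis using l(2) by (simp add: commute)
    qed
    ultimately have "prodl m (subst_word p ?w) = b" using const by blast
    then have "prodl m (subst_word (compose_word p (W l)) x) = b"
      by (simp only: prodl_compose_word[OF pS words_ne[OF p] W_words[OF lS] x] W_val[OF lS x])
    with l(1) show "\<exists>(l, c)\<in>F. prodl m (subst_word l x) = c" by (auto simp: F_def)
  qed
qed

end

theorem corollary1:
  fixes \<C> :: "'b topsemi set"
    and S :: "'a set" and m :: "'a \<Rightarrow> 'a \<Rightarrow> 'a"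
  assumes "|UNIV :: real set| \<le>o |UNIV :: 'b set|"
    and "\<forall>Y\<in>\<C>. topological_semigroup Y"
    and "\<forall>Y :: 'b topsemi. zero_discrete_semigroup Y \<and> Hausdorff_space (snd Y) \<longrightarrow> Y \<in> \<C>"
    and "\<forall>Y :: 'b topsemi. polish_semigroup Y \<longrightarrow> Y \<in> \<C>"
    and "semigroup_on S m"
    and "injectively_closed \<C> S m"
    and "\<exists>d. Metric_space S d \<and> separable_space (Metric_space.mtopology S d) \<and> subinvariant S m d"
    and "cov_meager =o |UNIV :: real set|"
  shows "polybounded S m"
proof (cases "S = {}")
  case True
  then show ?thesis
    unfolding polybounded_def by (intro exI[of _ "{}"]) simp
next
  case False
  obtain d where d: "Metric_space S d" "separable_space (Metric_space.mtopology S d)" "subinvariant S m d"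
    using assms(7) by blast
  interpret subinvariant_semigroup S m d
    using assms(5) d(1,3)
    by (intro subinvariant_semigroup.intro carrier_semigroup.intro subinvariant_semigroup_axioms.intro)
  have "zero_closed S m"
    using injectively_closed_imp_zero_closed[OF assms(1) separable_card_le_continuum[OF d(2)] assms(3,5,6)] .
  moreover have mcomplete
    using injectively_closed_imp_mcomplete[OF assms(1,4,6) d(2) False] .
  ultimately show ?thesis
    using zero_closed_imp_polybounded d(2) assms(8) by blast
qed

end
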